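(* Let $i\in\mathbb{Z}$ and let $k\ge1$ be an integer with $0\le i\le k$. Let $A^{-1}$ be the $(k+1)\times(k+1)$ matrix given in the context. Then $$q^{-\frac{i^2}{2(2k+1)}}\,\frac{(-q^{1/2})_\infty}{(q)_\infty}\sum_{n\in\mathbb{Z}}(2n+1)\,q^{\frac{2k+1}{2}\left(n+\frac{i}{2k+1}\right)^2}$$ $$=\sum_{\substack{n_1,n_2,\dots,n_{k+1}\ge0\\ n_k\equiv n_{k+1}\ (\mathrm{mod}\ 2)}}\frac{q^{\frac12\,\mathbf{n}\cdot A^{-1}\cdot\mathbf{n}^T+n_{k-i+1}+2n_{k-i+2}+\cdots+(i-1)n_{k-1}+\frac{i}{2}(n_k+n_{k+1})}\,(-q^{1/2})_{n_1+n_2+\cdots+n_{k-1}+\frac{n_k+n_{k+1}}{2}}}{(q)_{n_1}(q)_{n_2}\cdots(q)_{n_{k+1}}},$$ where $\mathbf{n}=(n_1,\dots,n_{k+1})$.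
   Context: Conventions: $q=e^{2\pi i\tau}$ with $\operatorname{Im}\tau>0$ (so $|q|<1$), and $q^r:=e^{2\pi i r\tau}$ for rational $r$ (here, in $e^{2\pi i\tau}$, $i$ is the imaginary unit; elsewhere $i$ is an integer index). The $q$-Pochhammer symbols are $(a)_n=(a;q)_n:=\prod_{j=1}^n(1-aq^{j-1})$ for $n\ge0$, $(a)_\infty:=\prod_{j\ge1}(1-aq^{j-1})$. The symmetric $(k+1)\times(k+1)$ matrix $A^{-1}$ has entries $(A^{-1})_{r,s}=\min\{2r-1,2s-1\}$ for $1\le r,s\le k-1$; $(A^{-1})_{r,s}=(A^{-1})_{s,r}=\frac{2s-1}{2}$ for $1\le s\le k-1$ and $r\in\{k,k+1\}$; $(A^{-1})_{k,k}=(A^{-1})_{k+1,k+1}=\frac{2k+1}{4}$; $(A^{-1})_{k,k+1}=(A^{-1})_{k+1,k}=\frac{2k-3}{4}$. For $k=1$ this is $\begin{pmatrix}\frac34&-\frac14\\-\frac14&\frac34\end{pmatrix}$. For $k\ge2$ it is the inverse of $A=\frac12(D_{k+1}+E_{1,1})$, where $D_{k+1}$ is the Cartan matrix of type $D_{k+1}$ (with the last two nodes $k$ and $k+1$ both attached to node $k-1$) and $E_{1,1}$ is the matrix unit. The linear expression $n_{k-i+1}+2n_{k-i+2}+\cdots+(i-1)n_{k-1}$ means $\sum_{j=k-i+1}^{k-1}(j-k+i)\,n_j$, which is empty (zero) when $i\le 1$. *)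

theory Defs
  imports "HOL-Analysis.Analysis" "HOL-Number_Theory.Cong"
begin

definition qpow :: "complex \<Rightarrow> real \<Rightarrow> complex" where
  "qpow \<tau> r = exp (2 * of_real pi * \<i> * of_real r * \<tau>)"

definition qpoch :: "complex \<Rightarrow> complex \<Rightarrow> nat \<Rightarrow> complex" where
  "qpoch a q n = (\<Prod>j=1..n. 1 - a * q ^ (j - 1))"

definition qpoch_inf :: "complex \<Rightarrow> complex \<Rightarrow> complex" where
  "qpoch_inf a q = (\<Prod>j. 1 - a * q ^ j)"

text \<open>Entries of the symmetric \<open>(k+1) \<times> (k+1)\<close> matrix \<open>A\<^sup>-\<^sup>1\<close>, with rows and
  columns numbered from 1. Only the values at \<open>1 \<le> r, s \<le> k + 1\<close> are meaningful.
  For \<open>k \<ge> 2\<close> it is the inverse of half the sum of the Cartan matrix of type \<open>D\<close> of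
  rank \<open>k + 1\<close> and the matrix unit at position \<open>(1, 1)\<close>.\<close>

definition A_inv :: "nat \<Rightarrow> nat \<Rightarrow> nat \<Rightarrow> real" where
  "A_inv k r s =
    (if r < k \<and> s < k then min (2 * real r - 1) (2 * real s - 1)
     else if s < k then (2 * real s - 1) / 2
     else if r < k then (2 * real r - 1) / 2
     else if r = s then (2 * real k + 1) / 4
     else (2 * real k - 3) / 4)"

definition quad_form :: "nat \<Rightarrow> (nat \<Rightarrow> nat) \<Rightarrow> real" where
  "quad_form k n = (\<Sum>r=1..k+1. \<Sum>s=1..k+1. real (n r) * A_inv k r s * real (n s))"

text \<open>For \<open>k \<ge> 1\<close> and \<open>i \<le> k\<close> the natural-number subtractions below do not truncate;
  the range of summation is empty for \<open>i \<le> 1\<close>.\<close>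

definition lin_form :: "nat \<Rightarrow> nat \<Rightarrow> (nat \<Rightarrow> nat) \<Rightarrow> real" where
  "lin_form k i n =
    (\<Sum>j=k-i+1..k-1. real (j + i - k) * real (n j)) + real i / 2 * real (n k + n (k + 1))"

text \<open>The tuples \<open>(n\<^sub>1, \<dots>, n\<^sub>k\<^sub>+\<^sub>1)\<close> are extensional functions on \<open>{1..k+1}\<close>, so that each
  tuple occurs exactly once in a sum over this set.\<close>

definition tuples :: "nat \<Rightarrow> (nat \<Rightarrow> nat) set" where
  "tuples k = {n \<in> {1..k+1} \<rightarrow>\<^sub>E UNIV. [n k = n (k + 1)] (mod 2)}"

text \<open>On \<^term>\<open>tuples k\<close> the division by 2 in the Pochhammer index is exact.\<close>

definition tuple_term :: "complex \<Rightarrow> nat \<Rightarrow> nat \<Rightarrow> (nat \<Rightarrow> nat) \<Rightarrow> complex" where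
  "tuple_term \<tau> k i n =
    qpow \<tau> (quad_form k n / 2 + lin_form k i n)
      * qpoch (- qpow \<tau> (1/2)) (qpow \<tau> 1) ((\<Sum>j=1..k-1. n j) + (n k + n (k + 1)) div 2)
      / (\<Prod>j=1..k+1. qpoch (qpow \<tau> 1) (qpow \<tau> 1) (n j))"

definition theta_term :: "complex \<Rightarrow> nat \<Rightarrow> nat \<Rightarrow> int \<Rightarrow> complex" where
  "theta_term \<tau> k i n =
    of_int (2 * n + 1)
      * qpow \<tau> ((2 * real k + 1) / 2 * (real_of_int n + real i / (2 * real k + 1))\<^sup>2)"

end

theory Submission imports Defs begin

text \<open>The identity is an iterated Bailey lemma. Put \<open>x = q\<^sup>1\<^sup>/\<^sup>2\<close>, write \<open>(q)\<^sub>n\<close> for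
  \<open>qfac q n\<close>, and set \<open>m = (n\<^sub>k + n\<^sub>k\<^sub>+\<^sub>1)/2\<close>, \<open>j = (n\<^sub>k - n\<^sub>k\<^sub>+\<^sub>1)/2\<close> and
  \<open>N\<^sub>r = n\<^sub>r + \<dots> + n\<^sub>k\<^sub>-\<^sub>1 + m\<close> for \<open>1 \<le> r \<le> k\<close>. The exponent of \<open>q\<close> in the multiple sum becomes
  \<open>N\<^sub>1\<^sup>2/2 + N\<^sub>2\<^sup>2 + \<dots> + N\<^sub>k\<^sup>2 + j\<^sup>2 + (N\<^sub>k\<^sub>-\<^sub>i\<^sub>+\<^sub>1 + \<dots> + N\<^sub>k)\<close> (lemma \<open>tuple_exponent\<close>), so that, for fixed
  \<open>N\<^sub>1\<close>, the sum over the remaining variables is a chain of sums over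
  \<open>N\<^sub>2 \<ge> \<dots> \<ge> N\<^sub>k\<close> whose innermost member is the sum over \<open>\<bar>j\<bar> \<le> N\<^sub>k\<close> of
  \<open>q\<^bsup>j\<^sup>2\<^esup> / ((q)\<^bsub>N\<^sub>k+j\<^esub> (q)\<^bsub>N\<^sub>k-j\<^esub>)\<close> (lemma \<open>sum_tails\<close>).

  Let \<open>b\<^sub>e(s, L) = 1 / ((q)\<^bsub>L-s\<^esub> (q)\<^bsub>L+s+e\<^esub>)\<close>, the kernel of a Bailey pair relative to \<open>q\<^sup>e\<close>, up to
  normalization, where \<open>e\<close> is 0 or 1. Multiplying by \<open>q\<^bsup>N\<^sup>2+eN\<^esup>/(q)\<^bsub>L-N\<^esub>\<close> and
  summing over \<open>N\<close> maps \<open>b\<^sub>e(s, N)\<close> to \<open>q\<^bsup>s\<^sup>2+es\<^esup> b\<^sub>e(s, L)\<close> (\<open>bailey_coeff_step\<close>, a case of the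
  \<open>q\<close>-Vandermonde sum). The \<open>i\<close> inner levels carry a linear term and need \<open>e = 1\<close>, the others
  need \<open>e = 0\<close>; one passes between the two by
  \<open>b\<^sub>0(s, L) - q\<^bsup>2s+1\<^esup> b\<^sub>0(s+1, L) = (1 - q\<^bsup>2s+1\<^esup>) b\<^sub>1(s, L)\<close>. The factor \<open>2n + 1\<close> of the theta
  series comes from the innermost sum: by symmetry in \<open>j\<close> and summation by parts,
  it equals the sum of
  \<open>(2s+1) q\<^bsup>s\<^sup>2\<^esup> (b\<^sub>0(s, L) - q\<^bsup>2s+1\<^esup> b\<^sub>0(s+1, L))\<close> over \<open>s \<ge> 0\<close> (\<open>bailey_chain_0\<close>). Iterating gives a closed form for
  the chain (\<open>bailey_chain_eq\<close>).

  The outermost level is an infinite sum with the extra factor \<open>(-x)\<^bsub>N\<^sub>1\<^esub>\<close>. It is evaluated by a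
  limiting case of the \<open>q\<close>-Gauss sum (\<open>q_gauss_limit\<close>), proved by a telescoping recurrence whose
  parameter is sent to infinity. What remains is the theta series with the terms of index \<open>s\<close> and
  \<open>-s - 1\<close> added together. Interchanging the sums over \<open>N\<^sub>1\<close> and \<open>s\<close>, and grouping the
  tuples by \<open>N\<^sub>1\<close>, are justified by absolute convergence (\<open>bailey_chain_total\<close>, \<open>tuple_term_abs_summable\<close>).\<close>

section \<open>Finite q-Pochhammer symbols\<close>

text \<open>The symbol \<open>(q)\<^sub>n = (q; q)\<^sub>n\<close>.\<close>
abbreviation qfac :: "complex \<Rightarrow> nat \<Rightarrow> complex" where
  "qfac q n \<equiv> qpoch q q n"

lemma qpoch_0 [simp]: "qpoch a q 0 = 1"
  by (simp add: qpoch_def)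

lemma qpoch_Suc: "qpoch a q (Suc n) = qpoch a q n * (1 - a * q ^ n)"
  by (simp add: qpoch_def)

lemma qfac_Suc: "qfac q (Suc n) = qfac q n * (1 - q ^ Suc n)"
  by (simp add: qpoch_Suc)

lemma one_minus_power_nonzero:
  fixes q :: complex
  assumes "norm q < 1" "n > 0"
  shows "1 - q ^ n \<noteq> 0"
proof
  assume "1 - q ^ n = 0"
  then have "norm (q ^ n) = 1" by simp
  moreover have "norm q ^ n < 1" using assms by (simp add: power_Suc_less_one power_less_one_iff)
  ultimately show False by (simp add: norm_power)
qed

lemma qpoch_nonzero:
  assumes "norm a < 1" "norm q < 1"
  shows "qpoch a q n \<noteq> 0"
proof (induction n)
  case (Suc n)
  have "norm (a * q ^ n) \<le> norm a"
    using assms by (simp add: norm_mult norm_power mult_left_le power_le_one)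
  then have "1 - a * q ^ n \<noteq> 0" using assms(1) by auto
  with Suc show ?case by (simp add: qpoch_Suc)
qed simp

lemma qfac_nonzero: "norm q < 1 \<Longrightarrow> qfac q n \<noteq> 0"
  by (simp add: qpoch_nonzero)

section \<open>The Bailey step\<close>

text \<open>A limiting case of the \<open>q\<close>-Vandermonde sum. If \<open>S(n, d)\<close> denotes the left-hand side,
  then \<open>(1 - q\<^sup>n) S(n, d) = S(n - 1, d + 1)\<close>, whence induction on \<open>n\<close>.\<close>
lemma q_vandermonde_limit:
  assumes q: "norm q < 1"
  shows "(\<Sum>M\<le>n. q ^ (M * (M + d)) / (qfac q M * qfac q (M + d) * qfac q (n - M)))
       = 1 / (qfac q n * qfac q (n + d))"
proof (induction n arbitrary: d)
  case 0
  show ?case by simp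
next
  case (Suc n)
  note nz = qfac_nonzero[OF q]
  define u where "u M = q ^ (M * (M + d)) / (qfac q M * qfac q (M + d) * qfac q (Suc n - M))" for M
  define v where "v M = q ^ (M * (M + Suc d)) / (qfac q M * qfac q (M + Suc d) * qfac q (n - M))" for M
  define w where "w M = q ^ (Suc M * (Suc M + d)) / (qfac q M * qfac q (M + Suc d) * qfac q (n - M))" for M
  have 1: "q ^ M * (1 - q ^ (Suc n - M)) * u M = v M - w M" if "M \<le> n" for M
  proof -
    have e: "Suc n - M = Suc (n - M)" using that by simp
    have k: "1 - q ^ Suc (n - M) \<noteq> 0" "1 - q ^ Suc (M + d) \<noteq> 0"
      using one_minus_power_nonzero[OF q] by blast+
    have p: "q ^ (M * (M + Suc d)) = q ^ (M * (M + d)) * q ^ M"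
      "q ^ (Suc M * (Suc M + d)) = q ^ (M * (M + d)) * q ^ M * q ^ Suc (M + d)"
      by (simp_all add: power_add [symmetric] algebra_simps)
    have "q ^ M * (1 - q ^ (Suc n - M)) * u M
        = q ^ (M * (M + d)) * q ^ M / (qfac q M * qfac q (M + d) * qfac q (n - M))"
      unfolding u_def e qfac_Suc using k nz by (simp add: divide_simps)
    also have "\<dots> = q ^ (M * (M + d)) * q ^ M * (1 - q ^ Suc (M + d)) / (qfac q M * qfac q (M + Suc d) * qfac q (n - M))"
      unfolding add_Suc_right qfac_Suc using k nz by (simp add: divide_simps)
    also have "\<dots> = v M - w M"
      unfolding v_def w_def p by (simp add: diff_divide_distrib right_diff_distrib)
    finally show ?thesis .
  qed
  have 2: "(1 - q ^ Suc M) * u (Suc M) = w M" for M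
  proof -
    have k: "1 - q ^ Suc M \<noteq> 0" using one_minus_power_nonzero[OF q] by blast
    show ?thesis unfolding u_def w_def qfac_Suc using k nz by (simp add: divide_simps)
  qed
  \<comment> \<open>split the factor as \<open>1 - q\<^bsup>n+1\<^esup> = q\<^sup>M (1 - q\<^bsup>n+1-M\<^esup>) + (1 - q\<^sup>M)\<close> in the summand of index \<open>M\<close>;
    the contributions of \<open>w\<close> cancel after a shift of index\<close>
  have "(1 - q ^ Suc n) * (\<Sum>M\<le>Suc n. u M)
      = (\<Sum>M\<le>Suc n. q ^ M * (1 - q ^ (Suc n - M)) * u M + (1 - q ^ M) * u M)"
  proof -
    have "(1 - q ^ Suc n) * u M = q ^ M * (1 - q ^ (Suc n - M)) * u M + (1 - q ^ M) * u M"
      if "M \<le> Suc n" for M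
    proof -
      have "q ^ Suc n = q ^ M * q ^ (Suc n - M)" using that by (simp add: power_add [symmetric] del: power_Suc)
      then show ?thesis by (simp add: algebra_simps del: power_Suc)
    qed
    then show ?thesis unfolding sum_distrib_left by (intro sum.cong) auto
  qed
  also have "\<dots> = (\<Sum>M\<le>Suc n. q ^ M * (1 - q ^ (Suc n - M)) * u M) + (\<Sum>M\<le>Suc n. (1 - q ^ M) * u M)"
    by (rule sum.distrib)
  also have "(\<Sum>M\<le>Suc n. q ^ M * (1 - q ^ (Suc n - M)) * u M) = (\<Sum>M\<le>n. v M - w M)"
    using 1 by simp
  also have "(\<Sum>M\<le>Suc n. (1 - q ^ M) * u M) = (\<Sum>M\<le>n. w M)"
    unfolding sum.atMost_Suc_shift using 2 by simp
  also have "(\<Sum>M\<le>n. v M - w M) + (\<Sum>M\<le>n. w M) = (\<Sum>M\<le>n. v M)"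
    by (simp add: sum_subtractf)
  also have "\<dots> = 1 / (qfac q n * qfac q (n + Suc d))"
    unfolding v_def by (rule Suc.IH)
  finally have "(1 - q ^ Suc n) * (\<Sum>M\<le>Suc n. u M) = 1 / (qfac q n * qfac q (n + Suc d))" .
  moreover have "1 - q ^ Suc n \<noteq> 0" using one_minus_power_nonzero[OF q] by blast
  ultimately have "(\<Sum>M\<le>Suc n. u M) = 1 / (qfac q n * qfac q (n + Suc d)) / (1 - q ^ Suc n)"
    by (metis nonzero_eq_divide_eq mult.commute)
  also have "\<dots> = 1 / (qfac q (Suc n) * qfac q (Suc n + d))"
    by (simp add: qfac_Suc[of q n] mult_ac del: power_Suc)
  finally have "(\<Sum>M\<le>Suc n. u M) = 1 / (qfac q (Suc n) * qfac q (Suc n + d))" .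
  then show ?case unfolding u_def .
qed

text \<open>The coefficient with which the \<open>s\<close>-th member of the first sequence of a Bailey pair relative to
  \<open>q\<^sup>e\<close> enters the \<open>L\<close>-th member of the second, up to the constant factor \<open>(q)\<^sub>e\<close>. It vanishes for
  \<open>s > L\<close>, in accordance with the convention \<open>1/(q)\<^sub>n = 0\<close> for \<open>n < 0\<close>; the case distinction
  is needed because subtraction on the natural numbers truncates.\<close>
definition bailey_coeff :: "complex \<Rightarrow> nat \<Rightarrow> nat \<Rightarrow> nat \<Rightarrow> complex" where
  "bailey_coeff q e s L = (if s \<le> L then 1 / (qfac q (L - s) * qfac q (L + s + e)) else 0)"

text \<open>The Bailey lemma with both parameters sent to infinity, on a single coefficient.\<close>
lemma bailey_coeff_step:
  assumes q: "norm q < 1"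
  shows "(\<Sum>N\<le>L. q ^ (N\<^sup>2 + e * N) * bailey_coeff q e s N / qfac q (L - N)) = q ^ (s\<^sup>2 + e * s) * bailey_coeff q e s L"
proof (cases "s \<le> L")
  case True
  define n where "n = L - s"
  have L: "L = s + n" using True by (simp add: n_def)
  have "(\<Sum>N\<le>L. q ^ (N\<^sup>2 + e * N) * bailey_coeff q e s N / qfac q (L - N))
      = (\<Sum>N\<in>{s..s+n}. q ^ (N\<^sup>2 + e * N) * bailey_coeff q e s N / qfac q (L - N))"
    by (rule sum.mono_neutral_right) (auto simp: L bailey_coeff_def)
  also have "\<dots> = (\<Sum>M\<le>n. q ^ ((s + M)\<^sup>2 + e * (s + M)) * bailey_coeff q e s (s + M) / qfac q (n - M))"
    by (rule sum.reindex_bij_witness[of _ "\<lambda>M. s + M" "\<lambda>N. N - s"]) (auto simp: L add.commute[of n])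
  also have "\<dots> = (\<Sum>M\<le>n. q ^ (s\<^sup>2 + e * s) * (q ^ (M * (M + (2 * s + e))) / (qfac q M * qfac q (M + (2 * s + e)) * qfac q (n - M))))"
  proof (rule sum.cong)
    fix M
    have a: "(s + M)\<^sup>2 + e * (s + M) = (s\<^sup>2 + e * s) + M * (M + (2 * s + e))"
      by (simp add: power2_eq_square algebra_simps)
    have b: "s + M + s + e = M + (2 * s + e)" by simp
    show "q ^ ((s + M)\<^sup>2 + e * (s + M)) * bailey_coeff q e s (s + M) / qfac q (n - M)
      = q ^ (s\<^sup>2 + e * s) * (q ^ (M * (M + (2 * s + e))) / (qfac q M * qfac q (M + (2 * s + e)) * qfac q (n - M)))"
      unfolding a bailey_coeff_def b power_add[of q "s\<^sup>2 + e * s"] by simp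
  qed simp
  also have "\<dots> = q ^ (s\<^sup>2 + e * s) * (1 / (qfac q n * qfac q (n + (2 * s + e))))"
    by (simp only: sum_distrib_left [symmetric] q_vandermonde_limit[OF q])
  also have "\<dots> = q ^ (s\<^sup>2 + e * s) * bailey_coeff q e s L"
  proof -
    have b: "s + n + s + e = n + (2 * s + e)" by simp
    show ?thesis unfolding bailey_coeff_def L b by simp
  qed
  finally show ?thesis .
next
  case False
  then have "bailey_coeff q e s N = 0" if "N \<le> L" for N using that by (simp add: bailey_coeff_def)
  with False show ?thesis by (simp add: bailey_coeff_def)
qed

text \<open>The change of base between Bailey pairs relative to \<open>1\<close> and to \<open>q\<close>.\<close>
lemma bailey_coeff_contiguous:
  assumes q: "norm q < 1"
  shows "bailey_coeff q 0 s L - q ^ (2 * s + 1) * bailey_coeff q 0 (Suc s) L = (1 - q ^ (2 * s + 1)) * bailey_coeff q 1 s L"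
proof -
  note nz = qfac_nonzero[OF q]
  consider "L < s" | "L = s" | n where "L = Suc (s + n)"
    by (metis add_Suc_right less_iff_Suc_add linorder_neqE_nat)
  then show ?thesis
  proof cases
    case 2
    have k: "1 - q ^ Suc (2 * s) \<noteq> 0" using one_minus_power_nonzero[OF q] by blast
    have "s + s + 1 = Suc (2 * s)" "s + s = 2 * s" by auto
    then show ?thesis using k nz[of "2 * s"]
      by (simp add: 2 bailey_coeff_def mult_2[symmetric] qfac_Suc del: power_Suc)
  next
    case 3
    define A where "A = qfac q n"
    define B where "B = qfac q (2 * s + n + 1)"
    have AB: "A \<noteq> 0" "B \<noteq> 0" using nz by (auto simp: A_def B_def)
    have k: "1 - q ^ Suc n \<noteq> 0" "1 - q ^ Suc (2 * s + n + 1) \<noteq> 0" using one_minus_power_nonzero[OF q] by blast+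
    have i: "Suc (s + n) - s = Suc n" "Suc (s + n) - Suc s = n" "Suc (s + n) + s + 0 = 2 * s + n + 1"
      "Suc (s + n) + s + 1 = Suc (2 * s + n + 1)" "Suc (s + n) + Suc s + 0 = Suc (2 * s + n + 1)"
      by auto
    have le: "s \<le> Suc (s + n)" "Suc s \<le> Suc (s + n)" by auto
    have p: "q ^ Suc (2 * s + n + 1) = q ^ (2 * s + 1) * q ^ Suc n"
      by (simp add: power_add [symmetric] )
    have *: "1 / (A * X * B) - Z * (1 / (A * (B * Y))) = (1 - Z) * (1 / (A * X * (B * Y)))"
      if "Y = 1 - Z * (1 - X)" "X \<noteq> 0" "Y \<noteq> 0" for X Y Z
    proof -
      have "Y - Z * X = 1 - Z" by (simp add: that(1) algebra_simps)
      then show ?thesis using that(2,3) AB by (simp add: divide_simps)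
    qed
    show ?thesis unfolding 3 bailey_coeff_def i qfac_Suc if_P[OF le(1)] if_P[OF le(2)] A_def[symmetric] B_def[symmetric]
      by (rule *) (use k p in auto)
  qed (simp add: bailey_coeff_def)
qed

section \<open>The Bailey chain\<close>

text \<open>The iterated inner sum: \<open>L\<close> is the current outer variable and \<open>m\<close> the number of levels already
  summed. The base case is the sum over the difference \<open>j = a - L\<close> of \<open>q\<^bsup>j\<^sup>2\<^esup>/((q)\<^bsub>L+j\<^esub> (q)\<^bsub>L-j\<^esub>)\<close>; it
  is indexed by \<open>a = L + j\<close>, which later plays the part of \<open>n\<^sub>k\<close>. The first \<open>i\<close> levels, counted
  from the innermost one, carry a linear term in the exponent.\<close>
fun bailey_chain :: "complex \<Rightarrow> nat \<Rightarrow> nat \<Rightarrow> nat \<Rightarrow> complex" where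
  "bailey_chain q i 0 L = (\<Sum>a\<le>2 * L. q ^ ((nat \<bar>int a - int L\<bar>)\<^sup>2) / (qfac q a * qfac q (2 * L - a)))"
| "bailey_chain q i (Suc m) L =
     (\<Sum>N\<le>L. q ^ (N\<^sup>2 + (if m < i then N else 0)) * bailey_chain q i m N / qfac q (L - N))"

text \<open>The combination of coefficients that is multiplied by \<open>2s + 1\<close> and a power of \<open>q\<close> in the closed
  form of the chain; \<open>t\<close> is the number of levels without a linear term that have been summed.\<close>
definition chain_kernel :: "complex \<Rightarrow> nat \<Rightarrow> nat \<Rightarrow> nat \<Rightarrow> complex" where
  "chain_kernel q t s L = bailey_coeff q 0 s L - q ^ ((t + 1) * (2 * s + 1)) * bailey_coeff q 0 (Suc s) L"

lemma chain_kernel_0: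
  assumes "norm q < 1"
  shows "chain_kernel q 0 s L = (1 - q ^ (2 * s + 1)) * bailey_coeff q 1 s L"
  using bailey_coeff_contiguous[OF assms, of s L] by (simp add: chain_kernel_def)

lemma chain_kernel_eq_0: "L < s \<Longrightarrow> chain_kernel q t s L = 0"
  by (simp add: chain_kernel_def bailey_coeff_def)

text \<open>A sum over \<open>-L \<le> j \<le> L\<close> of an even function of \<open>j = a - L\<close>.\<close>
lemma sum_symmetric:
  fixes c :: "nat \<Rightarrow> complex"
  shows "(\<Sum>a\<le>2 * L. c (nat \<bar>int a - int L\<bar>)) = 2 * (\<Sum>s\<le>L. c s) - c 0"
proof -
  have "{..2 * L} = {..<L} \<union> {L..2 * L}" by auto
  then have "(\<Sum>a\<le>2 * L. c (nat \<bar>int a - int L\<bar>))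
      = (\<Sum>a<L. c (nat \<bar>int a - int L\<bar>)) + (\<Sum>a\<in>{L..2 * L}. c (nat \<bar>int a - int L\<bar>))"
    by (simp add: sum.union_disjoint ivl_disj_int)
  also have "(\<Sum>a<L. c (nat \<bar>int a - int L\<bar>)) = (\<Sum>s\<in>{1..L}. c s)"
    by (rule sum.reindex_bij_witness[of _ "\<lambda>s. L - s" "\<lambda>a. L - a"]) (auto simp: nat_diff_distrib' intro!: arg_cong[of _ _ c])
  also have "(\<Sum>a\<in>{L..2 * L}. c (nat \<bar>int a - int L\<bar>)) = (\<Sum>s\<le>L. c s)"
    by (rule sum.reindex_bij_witness[of _ "\<lambda>s. L + s" "\<lambda>a. a - L"]) (auto simp: nat_diff_distrib' intro!: arg_cong[of _ _ c])
  also have "(\<Sum>s\<in>{1..L}. c s) = (\<Sum>s\<le>L. c s) - c 0"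
    by (simp add: atMost_atLeast0 sum.atLeast_Suc_atMost)
  finally show ?thesis by simp
qed

lemma sum_odd_multiples_of_differences:
  fixes c :: "nat \<Rightarrow> complex"
  shows "(\<Sum>s\<le>L. of_nat (2 * s + 1) * (c s - c (Suc s))) = 2 * (\<Sum>s\<le>L. c s) - c 0 - of_nat (2 * L + 1) * c (Suc L)"
  by (induction L) (simp_all add: algebra_simps)

text \<open>The source of the factor \<open>2s + 1\<close>: summation by parts of an even sum over \<open>j\<close>.\<close>
lemma bailey_chain_0:
  "bailey_chain q i 0 L = (\<Sum>s\<le>L. of_nat (2 * s + 1) * q ^ (s\<^sup>2) * chain_kernel q 0 s L)"
proof -
  define c where "c s = q ^ (s\<^sup>2) * bailey_coeff q 0 s L" for s
  have "bailey_chain q i 0 L = (\<Sum>a\<le>2 * L. c (nat \<bar>int a - int L\<bar>))"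
    unfolding bailey_chain.simps
  proof (rule sum.cong)
    fix a assume a: "a \<in> {..2 * L}"
    show "q ^ ((nat \<bar>int a - int L\<bar>)\<^sup>2) / (qfac q a * qfac q (2 * L - a)) = c (nat \<bar>int a - int L\<bar>)"
    proof (cases "a \<le> L")
      case True
      then obtain j where j: "L = a + j" by (auto simp: le_iff_add)
      have e: "nat \<bar>int a - int L\<bar> = j" "2 * L - a = L + j + 0" "L - j = a" "j \<le> L" unfolding j by auto
      show ?thesis unfolding c_def bailey_coeff_def e using e(4) by simp
    next
      case False
      then obtain j where j: "a = L + j" by (metis le_iff_add nat_le_linear)
      have e: "nat \<bar>int a - int L\<bar> = j" "2 * L - a = L - j" "L + j + 0 = a" "j \<le> L" using a unfolding j by auto
      show ?thesis unfolding c_def bailey_coeff_def e using e(4) by (simp add: mult.commute)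
    qed
  qed simp
  also have "\<dots> = 2 * (\<Sum>s\<le>L. c s) - c 0" by (rule sum_symmetric)
  also have "\<dots> = (\<Sum>s\<le>L. of_nat (2 * s + 1) * (c s - c (Suc s)))"
    unfolding sum_odd_multiples_of_differences by (simp add: c_def bailey_coeff_def)
  also have "\<dots> = (\<Sum>s\<le>L. of_nat (2 * s + 1) * q ^ (s\<^sup>2) * chain_kernel q 0 s L)"
  proof (rule sum.cong)
    fix s
    have "(Suc s)\<^sup>2 = s\<^sup>2 + (0 + 1) * (2 * s + 1)" by (simp add: power2_eq_square)
    then show "of_nat (2 * s + 1) * (c s - c (Suc s)) = of_nat (2 * s + 1) * q ^ (s\<^sup>2) * chain_kernel q 0 s L"
      unfolding c_def chain_kernel_def by (simp only: power_add) (simp only: algebra_simps)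
  qed simp
  finally show ?thesis .
qed

lemma chain_kernel_step:
  assumes q: "norm q < 1"
  shows "(\<Sum>N\<le>L. q ^ (N\<^sup>2 + (if m < i then N else 0)) * chain_kernel q (m - i) s N / qfac q (L - N))
       = q ^ (s\<^sup>2 + (if m < i then s else 0)) * chain_kernel q (Suc m - i) s L"
proof (cases "m < i")
  case True
  then have z: "m - i = 0" "Suc m - i = 0" by auto
  have "(\<Sum>N\<le>L. q ^ (N\<^sup>2 + N) * ((1 - q ^ (2 * s + 1)) * bailey_coeff q 1 s N) / qfac q (L - N))
      = (1 - q ^ (2 * s + 1)) * (\<Sum>N\<le>L. q ^ (N\<^sup>2 + 1 * N) * bailey_coeff q 1 s N / qfac q (L - N))"
    unfolding sum_distrib_left by (intro sum.cong) (auto simp: mult_ac)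
  also have "\<dots> = q ^ (s\<^sup>2 + s) * ((1 - q ^ (2 * s + 1)) * bailey_coeff q 1 s L)"
    unfolding bailey_coeff_step[OF q] by (simp add: mult_ac)
  finally show ?thesis unfolding z chain_kernel_0[OF q] using True by simp
next
  case False
  define t where "t = m - i"
  have t: "Suc m - i = Suc t" using False by (simp add: t_def)
  have "(\<Sum>N\<le>L. q ^ (N\<^sup>2) * chain_kernel q t s N / qfac q (L - N))
      = (\<Sum>N\<le>L. q ^ (N\<^sup>2 + 0 * N) * bailey_coeff q 0 s N / qfac q (L - N))
      - q ^ ((t + 1) * (2 * s + 1)) * (\<Sum>N\<le>L. q ^ (N\<^sup>2 + 0 * N) * bailey_coeff q 0 (Suc s) N / qfac q (L - N))"
    unfolding sum_distrib_left sum_subtractf[symmetric] chain_kernel_def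
    by (intro sum.cong) (auto simp: diff_divide_distrib right_diff_distrib mult_ac)
  also have "\<dots> = q ^ (s\<^sup>2) * bailey_coeff q 0 s L - q ^ ((t + 1) * (2 * s + 1) + (Suc s)\<^sup>2) * bailey_coeff q 0 (Suc s) L"
    unfolding bailey_coeff_step[OF q] unfolding power_add by (simp add: mult_ac)
  also have "(t + 1) * (2 * s + 1) + (Suc s)\<^sup>2 = s\<^sup>2 + (Suc t + 1) * (2 * s + 1)"
    by (simp add: power2_eq_square algebra_simps)
  also have "q ^ (s\<^sup>2) * bailey_coeff q 0 s L - q ^ (s\<^sup>2 + (Suc t + 1) * (2 * s + 1)) * bailey_coeff q 0 (Suc s) L
      = q ^ (s\<^sup>2) * chain_kernel q (Suc t) s L"
    unfolding chain_kernel_def power_add[of q "s\<^sup>2"] by (simp add: right_diff_distrib mult_ac)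
  finally show ?thesis using False unfolding t t_def[symmetric] by simp
qed

text \<open>In the closed form, each of the first \<open>i\<close> steps contributes \<open>q\<^bsup>s\<^sup>2+s\<^esup>\<close> and leaves the kernel unchanged;
  each later step contributes \<open>q\<^bsup>s\<^sup>2\<^esup>\<close> and raises the index \<open>t\<close> of the kernel by one.\<close>
lemma bailey_chain_eq:
  assumes q: "norm q < 1"
  shows "bailey_chain q i m L
       = (\<Sum>s\<le>L. of_nat (2 * s + 1) * q ^ ((m + 1) * s\<^sup>2 + min m i * s) * chain_kernel q (m - i) s L)"
proof (induction m arbitrary: L)
  case 0
  show ?case unfolding bailey_chain_0 by simp
next
  case (Suc m)
  define A where "A s = (of_nat (2 * s + 1) * q ^ ((m + 1) * s\<^sup>2 + min m i * s) :: complex)" for s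
  define w where "w N = q ^ (N\<^sup>2 + (if m < i then N else 0))" for N
  \<comment> \<open>the inner range can be taken independent of \<open>N\<close>, because the kernel vanishes for \<open>s > N\<close>\<close>
  have "bailey_chain q i m N = (\<Sum>s\<le>L. A s * chain_kernel q (m - i) s N)" if "N \<le> L" for N
    unfolding Suc.IH A_def using that
    by (intro sum.mono_neutral_left) (auto simp: chain_kernel_eq_0)
  then have "bailey_chain q i (Suc m) L = (\<Sum>N\<le>L. \<Sum>s\<le>L. A s * (w N * chain_kernel q (m - i) s N / qfac q (L - N)))"
    unfolding bailey_chain.simps w_def[symmetric]
    by (intro sum.cong) (simp_all add: sum_distrib_left sum_divide_distrib mult_ac)
  also have "\<dots> = (\<Sum>s\<le>L. \<Sum>N\<le>L. A s * (w N * chain_kernel q (m - i) s N / qfac q (L - N)))"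
    by (rule sum.swap)
  also have "\<dots> = (\<Sum>s\<le>L. A s * (w s * chain_kernel q (Suc m - i) s L))"
    unfolding sum_distrib_left[symmetric] w_def chain_kernel_step[OF q] by simp
  also have "\<dots> = (\<Sum>s\<le>L. of_nat (2 * s + 1) * q ^ ((Suc m + 1) * s\<^sup>2 + min (Suc m) i * s) * chain_kernel q (Suc m - i) s L)"
  proof (rule sum.cong)
    fix s
    have e: "(Suc m + 1) * s\<^sup>2 + min (Suc m) i * s = ((m + 1) * s\<^sup>2 + min m i * s) + (s\<^sup>2 + (if m < i then s else 0))"
      by (auto simp: algebra_simps min_def)
    show "A s * (w s * chain_kernel q (Suc m - i) s L)
      = of_nat (2 * s + 1) * q ^ ((Suc m + 1) * s\<^sup>2 + min (Suc m) i * s) * chain_kernel q (Suc m - i) s L"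
      unfolding e power_add[of q "(m + 1) * s\<^sup>2 + min m i * s"] A_def w_def by (simp only: mult.assoc)
  qed simp
  finally show ?case .
qed

section \<open>Convergence and bounds\<close>

lemma qpoch_LIMSEQ:
  assumes "norm q < 1"
  shows "qpoch a q \<longlonglongrightarrow> qpoch_inf a q"
    and "norm a < 1 \<Longrightarrow> qpoch_inf a q \<noteq> 0"
proof -
  have "summable (\<lambda>j. norm ((1 - a * q ^ j) - 1))"
    using assms by (simp add: norm_mult norm_power summable_mult summable_geometric)
  then have conv: "convergent_prod (\<lambda>j. 1 - a * q ^ j)"
    by (intro abs_convergent_prod_imp_convergent_prod summable_imp_abs_convergent_prod)
  have "qpoch a q (Suc n) = (\<Prod>j\<le>n. 1 - a * q ^ j)" for n
    by (induction n) (simp_all add: qpoch_Suc)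
  with convergent_prod_LIMSEQ[OF conv] have "(\<lambda>n. qpoch a q (Suc n)) \<longlonglongrightarrow> qpoch_inf a q"
    by (simp add: qpoch_inf_def)
  then show "qpoch a q \<longlonglongrightarrow> qpoch_inf a q" by (rule LIMSEQ_imp_Suc)
  assume a: "norm a < 1"
  have "1 - a * q ^ j \<noteq> 0" for j
    using qpoch_nonzero[OF a assms, of "Suc j"] by (simp add: qpoch_Suc)
  then show "qpoch_inf a q \<noteq> 0"
    unfolding qpoch_inf_def by (intro prodinf_nonzero[OF conv])
qed

lemma qpoch_bounded:
  assumes "norm q < 1"
  obtains C where "C > 0" "\<And>n. norm (qpoch a q n) \<le> C"
proof -
  have "Bseq (qpoch a q)"
    using qpoch_LIMSEQ(1)[OF assms] by (intro convergent_imp_Bseq convergentI)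
  then show ?thesis by (auto simp: Bseq_def intro: that)
qed

lemma inverse_qfac_bounded:
  assumes "norm q < 1"
  obtains C where "C > 0" "\<And>n. norm (1 / qfac q n) \<le> C"
proof -
  have "(\<lambda>n. 1 / qfac q n) \<longlonglongrightarrow> 1 / qpoch_inf q q"
    using qpoch_LIMSEQ[OF assms] assms by (intro tendsto_intros) auto
  then have "Bseq (\<lambda>n. 1 / qfac q n)"
    by (intro convergent_imp_Bseq convergentI)
  then show ?thesis by (auto simp: Bseq_def intro: that)
qed

lemma chain_kernel_bounded:
  assumes q: "norm q < 1"
  obtains C where "C > 0" "\<And>s L. norm (chain_kernel q t s L) \<le> C"
proof -
  obtain C where C: "C > 0" "\<And>n. norm (1 / qfac q n) \<le> C"
    using inverse_qfac_bounded[OF q] by blast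
  have b: "norm (bailey_coeff q 0 s L) \<le> C * C" for s L
  proof -
    have "norm ((1 / qfac q (L - s)) * (1 / qfac q (L + s + 0))) \<le> C * C"
      unfolding norm_mult using C(1) by (intro mult_mono C(2)) auto
    then show ?thesis using C(1) by (simp add: bailey_coeff_def)
  qed
  have "norm (chain_kernel q t s L) \<le> C * C + C * C" for s L
  proof -
    have "norm (q ^ ((t + 1) * (2 * s + 1)) * bailey_coeff q 0 (Suc s) L) \<le> 1 * (C * C)"
      unfolding norm_mult norm_power using q by (intro mult_mono b power_le_one) auto
    with b[of s L] show ?thesis unfolding chain_kernel_def
      using norm_triangle_ineq4[of "bailey_coeff q 0 s L" "q ^ ((t + 1) * (2 * s + 1)) * bailey_coeff q 0 (Suc s) L"] by linarith
  qed
  with that[of "C * C + C * C"] C(1) show ?thesis by simp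
qed

section \<open>A limiting case of the q-Gauss sum\<close>

text \<open>The summand, up to the factor \<open>(-x)\<^sub>a/(q)\<^bsub>a+e\<^esub>\<close>, of the limiting \<open>\<^sub>2\<phi>\<^sub>1\<close> series in base \<open>q = x\<^sup>2\<close> with upper
  parameter \<open>-x q\<^sup>a\<close> and lower parameter \<open>q\<^bsup>a+e+1\<^esup>\<close>, the other upper parameter having been sent to infinity.
  Working with the square root \<open>x\<close> of \<open>q\<close> keeps all exponents natural numbers.\<close>
definition gauss_term :: "complex \<Rightarrow> nat \<Rightarrow> nat \<Rightarrow> nat \<Rightarrow> complex" where
  "gauss_term x a e M =
     x ^ (M\<^sup>2 + 2 * e * M) * qpoch (- x) (x\<^sup>2) (a + M) / (qfac (x\<^sup>2) M * qfac (x\<^sup>2) (a + e + M))"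

lemma norm_power2_less_1: "norm (x::complex) < 1 \<Longrightarrow> norm (x\<^sup>2) < 1"
  by (simp add: norm_power power_less_one_iff)

lemma power_le_power_le_1:
  fixes x :: complex
  assumes "norm x < 1" "m \<le> n"
  shows "norm (x ^ n) \<le> norm x ^ m"
  using assms by (simp add: norm_power power_decreasing)

lemma gauss_term_bounded:
  assumes x: "norm x < 1"
  obtains C where "C > 0" "\<And>e M. norm (gauss_term x a e M) \<le> C * norm x ^ M"
proof -
  note q = norm_power2_less_1[OF x]
  obtain C where C: "C > 0" "\<And>n. norm (1 / qfac (x\<^sup>2) n) \<le> C"
    using inverse_qfac_bounded[OF q] by blast
  obtain D where D: "D > 0" "\<And>n. norm (qpoch (- x) (x\<^sup>2) n) \<le> D"
    using qpoch_bounded[OF q] by blast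
  have "norm (gauss_term x a e M) \<le> (D * (C * C)) * norm x ^ M" for e M
  proof -
    have "gauss_term x a e M = x ^ (M\<^sup>2 + 2 * e * M) * (qpoch (- x) (x\<^sup>2) (a + M)
         * ((1 / qfac (x\<^sup>2) M) * (1 / qfac (x\<^sup>2) (a + e + M))))"
      by (simp add: gauss_term_def)
    also have "norm \<dots> \<le> norm x ^ M * (D * (C * C))"
      unfolding norm_mult[of "x ^ _"] norm_mult[of "qpoch _ _ _"] norm_mult[of "1 / _"] using C(1) D(1)
      by (intro mult_mono power_le_power_le_1 x C(2) D(2)) (auto simp: power2_eq_square trans_le_add1)
    finally show ?thesis by (simp add: mult_ac)
  qed
  with that[of "D * (C * C)"] C(1) D(1) show ?thesis by simp
qed

lemma summable_gauss_term:
  assumes x: "norm x < 1"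
  shows "summable (\<lambda>M. norm (gauss_term x a e M))"
proof -
  obtain C where C: "C > 0" "\<And>e M. norm (gauss_term x a e M) \<le> C * norm x ^ M"
    using gauss_term_bounded[OF x, of a] by blast
  show ?thesis
    by (rule summable_comparison_test'[of "\<lambda>M. C * norm x ^ M"])
       (use C x in \<open>auto intro!: summable_mult summable_geometric\<close>)
qed

lemma q_gauss_recurrence:
  assumes x: "norm x < 1"
  shows "(\<Sum>M. gauss_term x a e M) = (1 + x ^ (2 * e + 1)) * (\<Sum>M. gauss_term x a (Suc e) M)"
proof -
  note q = norm_power2_less_1[OF x]
  note nz = qfac_nonzero[OF q]
  define z where "z = x ^ (2 * e + 1)"
  define p where "p M = x ^ (M\<^sup>2 + 2 * e * M) * qpoch (- x) (x\<^sup>2) (a + M) / (qfac (x\<^sup>2) M * qfac (x\<^sup>2) (Suc (a + e + M)))" for M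
  \<comment> \<open>telescoping certificate: \<open>g M - g (M + 1)\<close> is the difference of the summands of index \<open>M\<close> of both sides\<close>
  define g where "g M = (1 - (x\<^sup>2) ^ M) * gauss_term x a e M" for M
  have u: "gauss_term x a e M = p M * (1 - (x\<^sup>2) ^ Suc (a + e + M))" for M
    using nz one_minus_power_nonzero[OF q, of "Suc (a + e + M)"]
    unfolding gauss_term_def p_def qfac_Suc[of _ "a + e + M"] by (simp add: divide_simps)
  have v: "gauss_term x a (Suc e) M = p M * (x\<^sup>2) ^ M" for M
  proof -
    have "x ^ (M\<^sup>2 + 2 * Suc e * M) = x ^ (M\<^sup>2 + 2 * e * M) * (x\<^sup>2) ^ M"
      by (simp add: power_add [symmetric] power_mult [symmetric] algebra_simps)
    then show ?thesis unfolding gauss_term_def p_def by simp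
  qed
  have g_Suc: "g (Suc M) = p M * (x\<^sup>2) ^ M * z * (1 + x * (x\<^sup>2) ^ (a + M))" for M
  proof -
    have e: "x ^ ((Suc M)\<^sup>2 + 2 * e * Suc M) = x ^ (M\<^sup>2 + 2 * e * M) * ((x\<^sup>2) ^ M * z)"
      unfolding z_def by (simp add: power_add [symmetric] power_mult [symmetric] power2_eq_square algebra_simps)
    have i: "a + Suc M = Suc (a + M)" "a + e + Suc M = Suc (a + e + M)" by auto
    show ?thesis
      using nz[of M] nz[of "Suc (a + e + M)"] one_minus_power_nonzero[OF q, of "Suc M"]
      unfolding g_def gauss_term_def e i p_def qfac_Suc[of _ M] qpoch_Suc[of "- x"]
      by (simp add: divide_simps)
  qed
  have tele: "gauss_term x a e M - (1 + z) * gauss_term x a (Suc e) M = g M - g (Suc M)" for M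
  proof -
    define Q where "Q = (x\<^sup>2) ^ M"
    define T where "T = x * (x\<^sup>2) ^ (a + M)"
    have P: "(x\<^sup>2) ^ Suc (a + e + M) = z * T"
      unfolding T_def z_def by (simp add: power_add [symmetric] power_mult [symmetric] algebra_simps flip: power_Suc power_Suc2)
    show ?thesis
      unfolding g_Suc unfolding g_def u v P unfolding Q_def[symmetric] T_def[symmetric] by (simp add: algebra_simps)
  qed
  have "g \<longlonglongrightarrow> (1 - 0) * 0"
    unfolding g_def using q summable_gauss_term[OF x, of a e]
    by (intro tendsto_intros LIMSEQ_power_zero summable_LIMSEQ_zero) (auto dest: summable_norm_cancel)
  from telescope_sums'[OF this] have "(\<lambda>M. g M - g (Suc M)) sums 0"
    by (simp add: g_def)
  moreover have "(\<lambda>M. gauss_term x a e M - (1 + z) * gauss_term x a (Suc e) M) sums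
       ((\<Sum>M. gauss_term x a e M) - (1 + z) * (\<Sum>M. gauss_term x a (Suc e) M))"
    using summable_gauss_term[OF x]
    by (intro sums_diff sums_mult summable_sums) (auto dest: summable_norm_cancel)
  ultimately have "(\<Sum>M. gauss_term x a e M) - (1 + z) * (\<Sum>M. gauss_term x a (Suc e) M) = 0"
    unfolding tele by (rule sums_unique2[symmetric])
  then show ?thesis unfolding z_def by simp
qed

text \<open>By the recurrence the left-hand side does not depend on \<open>e\<close>. As \<open>e\<close> tends to infinity only
  the summand of index 0 survives.\<close>
lemma q_gauss_limit:
  assumes x: "norm x < 1"
  shows "qpoch (- x) (x\<^sup>2) e * (\<Sum>M. gauss_term x a e M)
       = qpoch_inf (- x) (x\<^sup>2) / qpoch_inf (x\<^sup>2) (x\<^sup>2) * qpoch (- x) (x\<^sup>2) a"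
proof -
  note q = norm_power2_less_1[OF x]
  define F where "F e = qpoch (- x) (x\<^sup>2) e * (\<Sum>M. gauss_term x a e M)" for e
  have "F (Suc e) = F e" for e
    unfolding F_def q_gauss_recurrence[OF x, of a e] qpoch_Suc
    by (simp add: power_mult [symmetric] mult_ac)
  then have const: "F e = F 0" for e
    by (induction e) auto
  obtain C where C: "C > 0" "\<And>e M. norm (gauss_term x a e M) \<le> C * norm x ^ M"
    using gauss_term_bounded[OF x, of a] by blast
  define b where "b M = (if M = 0 then qpoch (- x) (x\<^sup>2) a / qpoch_inf (x\<^sup>2) (x\<^sup>2) else 0)" for M :: nat
  have lim: "(\<lambda>e. gauss_term x a e M) \<longlonglongrightarrow> b M" for M
  proof -
    have shift: "(\<lambda>e. qfac (x\<^sup>2) (a + e + M)) \<longlonglongrightarrow> qpoch_inf (x\<^sup>2) (x\<^sup>2)"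
      using LIMSEQ_ignore_initial_segment[OF qpoch_LIMSEQ(1)[OF q, of "x\<^sup>2"], of "a + M"]
      by (simp add: add_ac)
    have pow: "(\<lambda>e. x ^ (M\<^sup>2 + 2 * e * M)) \<longlonglongrightarrow> (if M = 0 then 1 else 0)"
    proof (cases "M = 0")
      case False
      then have "norm (x ^ (2 * M)) < 1" using x by (simp add: norm_power power_less_one_iff)
      then have "(\<lambda>e. x ^ M\<^sup>2 * (x ^ (2 * M)) ^ e) \<longlonglongrightarrow> x ^ M\<^sup>2 * 0"
        by (intro tendsto_intros LIMSEQ_power_zero)
      with False show ?thesis by (simp add: power_add power_mult [symmetric] mult_ac)
    qed simp
    have "(\<lambda>e. gauss_term x a e M) \<longlonglongrightarrow>
        (if M = 0 then 1 else 0) * qpoch (- x) (x\<^sup>2) (a + M) / (qfac (x\<^sup>2) M * qpoch_inf (x\<^sup>2) (x\<^sup>2))"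
      unfolding gauss_term_def using qfac_nonzero[OF q] qpoch_LIMSEQ(2)[OF q q]
      by (intro tendsto_intros pow shift) auto
    then show ?thesis by (cases "M = 0") (simp_all add: b_def)
  qed
  have "(\<lambda>e. \<Sum>M. gauss_term x a e M) \<longlonglongrightarrow> suminf b"
  proof -
    have "eventually (\<lambda>(M, e). norm (gauss_term x a e M) \<le> C * norm x ^ M) (at_top \<times>\<^sub>F at_top)"
      using C(2) by (intro always_eventually) auto
    moreover have "summable (\<lambda>M. C * norm x ^ M)"
      using x by (intro summable_mult summable_geometric) simp
    ultimately show ?thesis
      using tannerys_theorem[of "\<lambda>M e. gauss_term x a e M" b at_top "\<lambda>M. C * norm x ^ M"] lim by simp
  qed
  also have "suminf b = qpoch (- x) (x\<^sup>2) a / qpoch_inf (x\<^sup>2) (x\<^sup>2)"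
    using suminf_finite[of "{0}" b] by (simp add: b_def)
  finally have "F \<longlonglongrightarrow> qpoch_inf (- x) (x\<^sup>2) * (qpoch (- x) (x\<^sup>2) a / qpoch_inf (x\<^sup>2) (x\<^sup>2))"
    unfolding F_def by (intro tendsto_intros qpoch_LIMSEQ(1) q)
  moreover have "F \<longlonglongrightarrow> F e"
    unfolding const[of e] using const by (simp add: LIMSEQ_const_iff tendsto_eventually)
  ultimately have "F e = qpoch_inf (- x) (x\<^sup>2) * (qpoch (- x) (x\<^sup>2) a / qpoch_inf (x\<^sup>2) (x\<^sup>2))"
    using LIMSEQ_unique by blast
  then show ?thesis by (simp add: F_def)
qed

section \<open>The outermost sum\<close>

text \<open>The limiting Bailey lemma with one parameter equal to \<open>-x\<close> and the other sent to infinity, on a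
  single coefficient.\<close>
lemma bailey_coeff_sums:
  assumes x: "norm x < 1"
  shows "(\<lambda>N. x ^ (N\<^sup>2 + 2 * e * N) * qpoch (- x) (x\<^sup>2) N * bailey_coeff (x\<^sup>2) e s N) sums
     (qpoch_inf (- x) (x\<^sup>2) / qpoch_inf (x\<^sup>2) (x\<^sup>2)
       * (x ^ (s\<^sup>2 + 2 * e * s) * qpoch (- x) (x\<^sup>2) s / qpoch (- x) (x\<^sup>2) (s + e)))"
proof -
  let ?f = "\<lambda>N. x ^ (N\<^sup>2 + 2 * e * N) * qpoch (- x) (x\<^sup>2) N * bailey_coeff (x\<^sup>2) e s N"
  note q = norm_power2_less_1[OF x]
  have nz: "qpoch (- x) (x\<^sup>2) (s + e) \<noteq> 0" using x q by (simp add: qpoch_nonzero)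
  have eq: "?f (M + s) = x ^ (s\<^sup>2 + 2 * e * s) * gauss_term x s (s + e) M" for M
  proof -
    have p: "(M + s)\<^sup>2 + 2 * e * (M + s) = (s\<^sup>2 + 2 * e * s) + (M\<^sup>2 + 2 * (s + e) * M)"
      by (simp add: power2_eq_square algebra_simps)
    have b: "bailey_coeff (x\<^sup>2) e s (M + s) = 1 / (qfac (x\<^sup>2) M * qfac (x\<^sup>2) (s + (s + e) + M))"
      by (simp add: bailey_coeff_def add_ac)
    show ?thesis unfolding gauss_term_def b p power_add[of x "s\<^sup>2 + 2 * e * s"]
      by (simp only: add.commute[of M s] mult.assoc times_divide_eq_right mult_1_right)
  qed
  have "(\<lambda>M. x ^ (s\<^sup>2 + 2 * e * s) * gauss_term x s (s + e) M) sums
      (x ^ (s\<^sup>2 + 2 * e * s) * (\<Sum>M. gauss_term x s (s + e) M))"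
    using summable_gauss_term[OF x] by (intro sums_mult summable_sums) (rule summable_norm_cancel)
  then have "?f sums (x ^ (s\<^sup>2 + 2 * e * s) * (\<Sum>M. gauss_term x s (s + e) M))"
    unfolding eq[symmetric] by (subst (asm) sums_zero_iff_shift) (auto simp: bailey_coeff_def)
  also have "(\<Sum>M. gauss_term x s (s + e) M) = qpoch_inf (- x) (x\<^sup>2) / qpoch_inf (x\<^sup>2) (x\<^sup>2)
       * qpoch (- x) (x\<^sup>2) s / qpoch (- x) (x\<^sup>2) (s + e)"
    using q_gauss_limit[OF x, of "s + e" s] unfolding nonzero_eq_divide_eq[OF nz] by (simp only: mult.commute)
  finally show ?thesis by (simp add: mult_ac)
qed

text \<open>The weight of the outermost variable \<open>N = N\<^sub>1\<close>, where \<open>m = k - 1\<close> levels lie below it. The exponent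
  \<open>N\<^sup>2/2\<close>, or \<open>N\<^sup>2/2 + N\<close> when the outermost level also carries a linear term (which
  happens exactly for \<open>i = k\<close>), is doubled, the base being \<open>x\<close> instead of \<open>q = x\<^sup>2\<close>.\<close>
definition outer_weight :: "complex \<Rightarrow> nat \<Rightarrow> nat \<Rightarrow> nat \<Rightarrow> complex" where
  "outer_weight x i m N = x ^ (N\<^sup>2 + (if m < i then 2 * N else 0)) * qpoch (- x) (x\<^sup>2) N"

lemma chain_kernel_sums:
  assumes x: "norm x < 1"
  shows "(\<lambda>N. outer_weight x i m N * chain_kernel (x\<^sup>2) (m - i) s N) sums
     (qpoch_inf (- x) (x\<^sup>2) / qpoch_inf (x\<^sup>2) (x\<^sup>2)
       * (if m < i then x ^ (s\<^sup>2 + 2 * s) * (1 - x ^ (2 * s + 1))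
          else x ^ s\<^sup>2 - x ^ (2 * ((m - i + 1) * (2 * s + 1)) + (Suc s)\<^sup>2)))"
proof -
  let ?c = "qpoch_inf (- x) (x\<^sup>2) / qpoch_inf (x\<^sup>2) (x\<^sup>2)"
  note q = norm_power2_less_1[OF x]
  have nz: "qpoch (- x) (x\<^sup>2) n \<noteq> 0" for n using x q by (simp add: qpoch_nonzero)
  show ?thesis
  proof (cases "m < i")
    case True
    have "(\<lambda>N. (1 - x ^ (2 * (2 * s + 1))) * (x ^ (N\<^sup>2 + 2 * 1 * N) * qpoch (- x) (x\<^sup>2) N * bailey_coeff (x\<^sup>2) 1 s N)) sums
      ((1 - x ^ (2 * (2 * s + 1))) * (?c * (x ^ (s\<^sup>2 + 2 * 1 * s) * qpoch (- x) (x\<^sup>2) s / qpoch (- x) (x\<^sup>2) (s + 1))))"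
      by (intro sums_mult bailey_coeff_sums[OF x])
    also have "(\<lambda>N. (1 - x ^ (2 * (2 * s + 1))) * (x ^ (N\<^sup>2 + 2 * 1 * N) * qpoch (- x) (x\<^sup>2) N * bailey_coeff (x\<^sup>2) 1 s N))
      = (\<lambda>N. outer_weight x i m N * chain_kernel (x\<^sup>2) (m - i) s N)"
    proof -
      have z: "m - i = 0" using True by simp
      have "chain_kernel (x\<^sup>2) (m - i) s N = (1 - x ^ (2 * (2 * s + 1))) * bailey_coeff (x\<^sup>2) 1 s N" for N
        using chain_kernel_0[OF q, of s N] unfolding z by (simp only: power_mult)
      then show ?thesis using True unfolding outer_weight_def by (simp add: mult_ac)
    qed
    also have "(1 - x ^ (2 * (2 * s + 1))) * (?c * (x ^ (s\<^sup>2 + 2 * 1 * s) * qpoch (- x) (x\<^sup>2) s / qpoch (- x) (x\<^sup>2) (s + 1)))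
      = ?c * (x ^ (s\<^sup>2 + 2 * s) * (1 - x ^ (2 * s + 1)))"
    proof -
      have *: "qpoch (- x) (x\<^sup>2) (s + 1) = qpoch (- x) (x\<^sup>2) s * (1 + x ^ (2 * s + 1))"
        by (simp add: qpoch_Suc power_mult)
      have "1 - x ^ (2 * (2 * s + 1)) = (1 - x ^ (2 * s + 1)) * (1 + x ^ (2 * s + 1))"
        unfolding mult.commute[of 2 "2 * s + 1"] power_mult by (simp add: power2_eq_square algebra_simps)
      moreover have "1 + x ^ (2 * s + 1) \<noteq> 0" using nz[of "s + 1"] unfolding * by auto
      ultimately show ?thesis using nz[of s] unfolding * by simp
    qed
    finally show ?thesis using True by simp
  next
    case False
    define t where "t = m - i"
    have b: "(\<lambda>N. x ^ N\<^sup>2 * qpoch (- x) (x\<^sup>2) N * bailey_coeff (x\<^sup>2) 0 s N) sums (?c * x ^ s\<^sup>2)" for s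
      using bailey_coeff_sums[OF x, of 0 s] nz by simp
    have "(\<lambda>N. x ^ N\<^sup>2 * qpoch (- x) (x\<^sup>2) N * bailey_coeff (x\<^sup>2) 0 s N
       - (x\<^sup>2) ^ ((t + 1) * (2 * s + 1)) * (x ^ N\<^sup>2 * qpoch (- x) (x\<^sup>2) N * bailey_coeff (x\<^sup>2) 0 (Suc s) N)) sums
      (?c * x ^ s\<^sup>2 - (x\<^sup>2) ^ ((t + 1) * (2 * s + 1)) * (?c * x ^ (Suc s)\<^sup>2))"
      by (intro sums_diff sums_mult b)
    also have "(\<lambda>N. x ^ N\<^sup>2 * qpoch (- x) (x\<^sup>2) N * bailey_coeff (x\<^sup>2) 0 s N
       - (x\<^sup>2) ^ ((t + 1) * (2 * s + 1)) * (x ^ N\<^sup>2 * qpoch (- x) (x\<^sup>2) N * bailey_coeff (x\<^sup>2) 0 (Suc s) N))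
      = (\<lambda>N. outer_weight x i m N * chain_kernel (x\<^sup>2) t s N)"
      using False unfolding outer_weight_def chain_kernel_def by (intro ext) (simp only: if_False add_0_right, simp only: algebra_simps)
    also have "?c * x ^ s\<^sup>2 - (x\<^sup>2) ^ ((t + 1) * (2 * s + 1)) * (?c * x ^ (Suc s)\<^sup>2)
       = ?c * (x ^ s\<^sup>2 - x ^ (2 * ((t + 1) * (2 * s + 1)) + (Suc s)\<^sup>2))"
      unfolding power_add[of x "2 * ((t + 1) * (2 * s + 1))"] power_mult[of x 2] by (simp only: algebra_simps)
    finally show ?thesis using False unfolding t_def by simp
  qed
qed

section \<open>Summation of the chain to a theta series\<close>

text \<open>The terms of index \<open>s\<close> and \<open>-s - 1\<close> of the theta series, including the prefactor \<open>q\<close> to the power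
  \<open>-i\<^sup>2/(2(2k+1))\<close>, added together and expressed in \<open>x = q\<^sup>1\<^sup>/\<^sup>2\<close>. By
  \<open>theta_exponent_bounds\<close> below, the subtraction in the exponent does not truncate when
  \<open>1 \<le> k\<close> and \<open>i \<le> k\<close>.\<close>
definition folded_theta :: "complex \<Rightarrow> nat \<Rightarrow> nat \<Rightarrow> nat \<Rightarrow> complex" where
  "folded_theta x k i s = of_nat (2 * s + 1) *
     (x ^ ((2 * k + 1) * s\<^sup>2 + 2 * i * s) - x ^ ((2 * k + 1) * (Suc s)\<^sup>2 - 2 * i * Suc s))"

lemma theta_exponent_bounds:
  assumes "k \<ge> 1" "i \<le> (k :: nat)"
  shows "2 * i * Suc s \<le> (2 * k + 1) * (Suc s)\<^sup>2" "s \<le> (2 * k + 1) * (Suc s)\<^sup>2 - 2 * i * Suc s"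
proof -
  obtain j where j: "k = i + j" using assms by (auto simp: le_iff_add)
  have *: "(2 * k + 1) * (Suc s)\<^sup>2 = 2 * i * Suc s + Suc s * ((2 * i + 2 * j + 1) * s + 2 * j + 1)"
    by (simp add: j power2_eq_square algebra_simps)
  show "2 * i * Suc s \<le> (2 * k + 1) * (Suc s)\<^sup>2" unfolding * by simp
  show "s \<le> (2 * k + 1) * (Suc s)\<^sup>2 - 2 * i * Suc s" unfolding * by simp
qed

lemma summable_odd_geometric:
  assumes "0 \<le> r" "r < (1::real)"
  shows "(\<lambda>s. real (2 * s + 1) * r ^ s) summable_on UNIV"
proof -
  have "summable (\<lambda>s. 2 * (of_nat (Suc s) * r ^ s))"
    using geometric_deriv_sums[of r] assms by (intro summable_mult) (auto simp: sums_iff)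
  then have "summable (\<lambda>s. norm (real (2 * s + 1) * r ^ s))"
  proof (rule summable_comparison_test')
    fix n :: nat
    show "norm (norm (real (2 * n + 1) * r ^ n)) \<le> 2 * (of_nat (Suc n) * r ^ n)"
      using assms by (simp add: algebra_simps mult_nonneg_nonneg)
  qed
  then show ?thesis by (rule norm_summable_imp_summable_on)
qed

text \<open>The powers collected from the \<open>k - 1\<close> inner levels, times the value from \<open>chain_kernel_sums\<close>, are
  the powers in the folded theta series, whether or not the outermost level has a linear term.\<close>
lemma chain_kernel_coefficient:
  assumes k: "k \<ge> 1" "i \<le> k"
  shows "(x\<^sup>2) ^ (k * s\<^sup>2 + min (k - 1) i * s) *
     (if k - 1 < i then x ^ (s\<^sup>2 + 2 * s) * (1 - x ^ (2 * s + 1))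
      else x ^ s\<^sup>2 - x ^ (2 * ((k - 1 - i + 1) * (2 * s + 1)) + (Suc s)\<^sup>2))
   = x ^ ((2 * k + 1) * s\<^sup>2 + 2 * i * s) - (x::complex) ^ ((2 * k + 1) * (Suc s)\<^sup>2 - 2 * i * Suc s)"
proof (cases "k - 1 < i")
  case True
  then have ik: "i = k" using k by simp
  obtain m where m: "k = Suc m" using k by (cases k) auto
  have 1: "2 * (k * s\<^sup>2 + min (k - 1) i * s) + (s\<^sup>2 + 2 * s) = (2 * k + 1) * s\<^sup>2 + 2 * i * s"
    by (simp add: ik m power2_eq_square algebra_simps)
  have 2: "(2 * k + 1) * (Suc s)\<^sup>2 - 2 * i * Suc s = ((2 * k + 1) * s\<^sup>2 + 2 * i * s) + (2 * s + 1)"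
    by (simp add: ik m power2_eq_square algebra_simps)
  have "(x\<^sup>2) ^ (k * s\<^sup>2 + min (k - 1) i * s) * (x ^ (s\<^sup>2 + 2 * s) * (1 - x ^ (2 * s + 1)))
     = x ^ (2 * (k * s\<^sup>2 + min (k - 1) i * s) + (s\<^sup>2 + 2 * s)) * (1 - x ^ (2 * s + 1))"
    unfolding power_add[of x "2 * (k * s\<^sup>2 + min (k - 1) i * s)"] power_mult[of x 2] by (simp only: mult.assoc)
  then show ?thesis using True unfolding 1 2 power_add[of x "(2 * k + 1) * s\<^sup>2 + 2 * i * s"]
    by (simp only: if_True right_diff_distrib mult_1_right)
next
  case False
  then obtain t where t: "k = Suc (i + t)" using k by (metis Suc_diff_1 le_add_diff_inverse not_less less_eq_Suc_le One_nat_def)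
  have mi: "min (k - 1) i = i" "k - 1 - i + 1 = Suc t" by (auto simp: t)
  have 1: "2 * (k * s\<^sup>2 + i * s) + s\<^sup>2 = (2 * k + 1) * s\<^sup>2 + 2 * i * s"
    by (simp add: algebra_simps)
  have 2: "2 * (k * s\<^sup>2 + i * s) + (2 * (Suc t * (2 * s + 1)) + (Suc s)\<^sup>2) = (2 * k + 1) * (Suc s)\<^sup>2 - 2 * i * Suc s"
  proof -
    have "2 * (k * s\<^sup>2 + i * s) + (2 * (Suc t * (2 * s + 1)) + (Suc s)\<^sup>2) + 2 * i * Suc s = (2 * k + 1) * (Suc s)\<^sup>2"
      by (simp add: t power2_eq_square algebra_simps)
    then show ?thesis by (metis add_diff_cancel_right')
  qed
  show ?thesis using False unfolding mi unfolding 1[symmetric] 2[symmetric] power_add[of x "2 * (k * s\<^sup>2 + i * s)"] power_mult[of x 2]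
    by (simp only: if_False right_diff_distrib)
qed

text \<open>Both sums are iterated sums of one absolutely summable double series in \<open>s\<close> and \<open>N\<close>.\<close>
lemma bailey_chain_total:
  assumes x: "norm x < 1" and k: "k \<ge> 1" "i \<le> k"
  obtains Z where
    "((\<lambda>s. qpoch_inf (- x) (x\<^sup>2) / qpoch_inf (x\<^sup>2) (x\<^sup>2) * folded_theta x k i s) has_sum Z) UNIV"
    "((\<lambda>N. outer_weight x i (k - 1) N * bailey_chain (x\<^sup>2) i (k - 1) N) has_sum Z) UNIV"
proof -
  note q = norm_power2_less_1[OF x]
  let ?c = "qpoch_inf (- x) (x\<^sup>2) / qpoch_inf (x\<^sup>2) (x\<^sup>2)"
  let ?r = "norm x"
  define A where "A s = of_nat (2 * s + 1) * (x\<^sup>2) ^ (k * s\<^sup>2 + min (k - 1) i * s)" for s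
  define W where "W = outer_weight x i (k - 1)"
  define K where "K = chain_kernel (x\<^sup>2) (k - 1 - i)"
  define F where "F = (\<lambda>(s, N). A s * (W N * K s N))"
  obtain C where C: "C > 0" "\<And>s N. norm (K s N) \<le> C"
    using chain_kernel_bounded[OF q, of "k - 1 - i"] unfolding K_def by blast
  obtain D where D: "D > 0" "\<And>n. norm (qpoch (- x) (x\<^sup>2) n) \<le> D"
    using qpoch_bounded[OF q] by blast
  have A: "norm (A s) \<le> real (2 * s + 1) * ?r ^ s" for s
  proof -
    have "s \<le> k * s\<^sup>2"
      by (rule order.trans[OF _ mult_le_mono1[OF k(1)]]) (simp add: power2_eq_square)
    then have "norm (x ^ (2 * (k * s\<^sup>2 + min (k - 1) i * s))) \<le> ?r ^ s"
      by (intro power_le_power_le_1 x) simp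
    then show ?thesis
      unfolding A_def power_mult[symmetric] norm_mult norm_of_nat
      by (intro mult_left_mono) simp_all
  qed
  have W: "norm (W N) \<le> D * ?r ^ N" for N
  proof -
    have "norm (W N) \<le> ?r ^ N * D"
      unfolding W_def outer_weight_def norm_mult
      by (intro mult_mono power_le_power_le_1 x D(2)) (auto simp: power2_eq_square trans_le_add1)
    then show ?thesis by (simp add: mult.commute)
  qed
  have F: "norm (F (s, N)) \<le> real (2 * s + 1) * ?r ^ s * (D * ?r ^ N * C)" for s N
    unfolding F_def prod.case norm_mult using D(1) C(1)
    by (intro mult_mono A W C(2)) auto
  have row: "summable (\<lambda>N. D * ?r ^ N * C)"
    using x by (intro summable_mult summable_mult2 summable_geometric) simp
  have "(\<lambda>(s, N). real (2 * s + 1) * ?r ^ s * (D * ?r ^ N * C)) summable_on UNIV \<times> UNIV"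
  proof (rule summable_on_SigmaI)
    show "((\<lambda>N. case (s, N) of (s, N) \<Rightarrow> real (2 * s + 1) * ?r ^ s * (D * ?r ^ N * C)) has_sum
        real (2 * s + 1) * ?r ^ s * (\<Sum>N. D * ?r ^ N * C)) UNIV" for s
      unfolding prod.case using row D(1) C(1)
      by (intro has_sum_cmult_right norm_summable_imp_has_sum summable_sums) (auto simp: abs_mult)
    show "(\<lambda>s. real (2 * s + 1) * ?r ^ s * (\<Sum>N. D * ?r ^ N * C)) summable_on UNIV"
      using x by (intro summable_on_cmult_left summable_odd_geometric) auto
  qed (use C(1) D(1) in auto)
  then have "(\<lambda>p. norm (F p)) summable_on UNIV \<times> UNIV"
    by (rule Infinite_Sum.abs_summable_on_comparison_test') (use F in auto)
  then have "F summable_on UNIV \<times> UNIV" by (rule abs_summable_summable)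
  then obtain Z where Z: "(F has_sum Z) (UNIV \<times> UNIV)" by (auto simp: summable_on_def)
  have 1: "((\<lambda>N. F (s, N)) has_sum (?c * folded_theta x k i s)) UNIV" for s
  proof (rule norm_summable_imp_has_sum)
    show "summable (\<lambda>N. norm (F (s, N)))"
      by (rule summable_comparison_test'[OF summable_mult[OF row, of "real (2 * s + 1) * ?r ^ s"]])
         (use F in simp)
    have "(\<lambda>N. F (s, N)) sums (A s * (?c * (if k - 1 < i then x ^ (s\<^sup>2 + 2 * s) * (1 - x ^ (2 * s + 1))
          else x ^ s\<^sup>2 - x ^ (2 * ((k - 1 - i + 1) * (2 * s + 1)) + (Suc s)\<^sup>2))))"
      unfolding F_def prod.case W_def K_def by (intro sums_mult chain_kernel_sums x)
    also have "A s * (?c * (if k - 1 < i then x ^ (s\<^sup>2 + 2 * s) * (1 - x ^ (2 * s + 1))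
          else x ^ s\<^sup>2 - x ^ (2 * ((k - 1 - i + 1) * (2 * s + 1)) + (Suc s)\<^sup>2))) = ?c * folded_theta x k i s"
      unfolding folded_theta_def chain_kernel_coefficient[OF k, symmetric] A_def by (simp only: mult_ac)
    finally show "(\<lambda>N. F (s, N)) sums (?c * folded_theta x k i s)" .
  qed
  have 2: "((\<lambda>s. F (s, N)) has_sum (W N * bailey_chain (x\<^sup>2) i (k - 1) N)) UNIV" for N
  proof (rule has_sum_finite_neutralI[of "{..N}"])
    have "k - 1 + 1 = k" using k by simp
    then show "W N * bailey_chain (x\<^sup>2) i (k - 1) N = (\<Sum>s\<le>N. F (s, N))"
      unfolding bailey_chain_eq[OF q] F_def prod.case A_def K_def by (simp add: sum_distrib_left mult_ac)
    show "F (s, N) = 0" if "s \<in> UNIV - {..N}" for s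
      using that by (simp add: F_def K_def chain_kernel_eq_0)
  qed auto
  have "((\<lambda>s. ?c * folded_theta x k i s) has_sum Z) UNIV"
    by (rule has_sum_SigmaD[OF Z 1])
  moreover have "((\<lambda>N. W N * bailey_chain (x\<^sup>2) i (k - 1) N) has_sum Z) UNIV"
    using has_sum_SigmaD[OF Z[unfolded has_sum_swap[of F]], of "\<lambda>N. W N * bailey_chain (x\<^sup>2) i (k - 1) N"] 2 by simp
  ultimately show ?thesis using that unfolding W_def by blast
qed

lemma has_sum_int_split:
  fixes f :: "int \<Rightarrow> complex"
  assumes "((\<lambda>n. f (int n)) has_sum a) UNIV" "((\<lambda>n. f (- int n - 1)) has_sum b) UNIV"
  shows "(f has_sum (a + b)) UNIV"
proof -
  have "bij_betw int UNIV {0..}" "bij_betw (\<lambda>n. - int n - 1) UNIV {..<0}"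
    by (rule bij_betwI[of _ _ _ nat]; force) (rule bij_betwI[of _ _ _ "\<lambda>n. nat (- n - 1)"]; force)
  with assms have "(f has_sum a) {0..}" "(f has_sum b) {..<0}"
    using has_sum_reindex_bij_betw by blast+
  then have "(f has_sum (a + b)) ({0..} \<union> {..<0})"
    by (rule has_sum_Un_disjoint) auto
  also have "{0..} \<union> {..<0} = (UNIV :: int set)" by auto
  finally show ?thesis .
qed

lemma qpow_add: "qpow \<tau> (a + b) = qpow \<tau> a * qpow \<tau> b"
  by (simp add: qpow_def exp_add[symmetric] algebra_simps)

lemma qpow_of_nat_mult: "qpow \<tau> (of_nat n * a) = qpow \<tau> a ^ n"
  by (simp add: qpow_def exp_of_nat_mult[symmetric] algebra_simps)

lemma norm_qpow_less_1:
  assumes "Im \<tau> > 0" "r > 0"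
  shows "norm (qpow \<tau> r) < 1"
  using assms by (simp add: qpow_def norm_exp_eq_Re)

lemma theta_has_sum:
  assumes \<tau>: "Im \<tau> > 0" and k: "k \<ge> 1" "i \<le> k"
    and Z: "(folded_theta (qpow \<tau> (1/2)) k i has_sum Z) UNIV"
  shows "((\<lambda>n. qpow \<tau> (- (real i)\<^sup>2 / (2 * (2 * real k + 1))) * theta_term \<tau> k i n) has_sum Z) UNIV"
proof -
  define x where "x = qpow \<tau> (1/2)"
  have x: "norm x < 1" unfolding x_def by (rule norm_qpow_less_1[OF \<tau>]) simp
  let ?f = "\<lambda>n. qpow \<tau> (- (real i)\<^sup>2 / (2 * (2 * real k + 1))) * theta_term \<tau> k i n"
  define e :: "nat \<Rightarrow> nat" where "e s = (2 * k + 1) * s\<^sup>2 + 2 * i * s" for s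
  define e' where "e' s = (2 * k + 1) * (Suc s)\<^sup>2 - 2 * i * Suc s" for s
  \<comment> \<open>completing the square: the prefactor removes the constant term of the exponent\<close>
  have f: "?f n = of_int (2 * n + 1) * qpow \<tau> (((2 * real k + 1) * (of_int n)\<^sup>2 + 2 * real i * of_int n) * (1/2))" for n
  proof -
    have "((2 * real k + 1) * (of_int n)\<^sup>2 + 2 * real i * of_int n) * (1/2)
      = - (real i)\<^sup>2 / (2 * (2 * real k + 1)) + (2 * real k + 1) / 2 * (of_int n + real i / (2 * real k + 1))\<^sup>2"
    proof -
      define K where "K = 2 * real k + 1"
      have "K \<noteq> 0" unfolding K_def by (simp add: add_nonneg_eq_0_iff)
      then show ?thesis unfolding K_def[symmetric] by (simp add: power2_eq_square field_simps)
    qed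
    then show ?thesis unfolding theta_term_def by (simp only: qpow_add) (simp only: mult_ac)
  qed
  have p: "?f (int s) = of_nat (2 * s + 1) * x ^ e s" for s
  proof -
    have "(2 * real k + 1) * (of_int (int s))\<^sup>2 + 2 * real i * of_int (int s) = real (e s)"
      by (simp add: e_def algebra_simps)
    then show ?thesis unfolding f x_def by (simp only: qpow_of_nat_mult) simp
  qed
  have n: "?f (- int s - 1) = - of_nat (2 * s + 1) * x ^ e' s" for s
  proof -
    have "(2 * real k + 1) * (of_int (- int s - 1))\<^sup>2 + 2 * real i * of_int (- int s - 1) = real (e' s)"
      unfolding e'_def of_nat_diff[OF theta_exponent_bounds(1)[OF k]] by (simp add: power2_eq_square algebra_simps)
    then show ?thesis unfolding f x_def by (simp only: qpow_of_nat_mult) (simp add: algebra_simps)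
  qed
  have sm: "(\<lambda>s. of_nat (2 * s + 1) * x ^ E s) summable_on UNIV" if "\<And>s. s \<le> E s" for E :: "nat \<Rightarrow> nat"
  proof -
    have "norm (of_nat (2 * s + 1) * x ^ E s) \<le> real (2 * s + 1) * norm x ^ s" for s
      unfolding norm_mult norm_of_nat by (intro mult_left_mono power_le_power_le_1 x that) simp
    then have "(\<lambda>s. norm (of_nat (2 * s + 1) * x ^ E s)) summable_on UNIV"
      using x by (intro Infinite_Sum.abs_summable_on_comparison_test'[OF summable_odd_geometric]) auto
    then show ?thesis by (rule abs_summable_summable)
  qed
  obtain a where a: "((\<lambda>s. of_nat (2 * s + 1) * x ^ e s) has_sum a) UNIV"
    using sm[of e] by (auto simp: summable_on_def e_def power2_eq_square trans_le_add1)
  obtain b where b: "((\<lambda>s. of_nat (2 * s + 1) * x ^ e' s) has_sum b) UNIV"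
    using sm[of e'] theta_exponent_bounds(2)[OF k] by (auto simp: summable_on_def e'_def)
  have "((\<lambda>s. of_nat (2 * s + 1) * x ^ e s - of_nat (2 * s + 1) * x ^ e' s) has_sum (a - b)) UNIV"
  proof -
    have "((\<lambda>s. - (of_nat (2 * s + 1) * x ^ e' s)) has_sum - b) UNIV"
      using b by (subst has_sum_uminus) simp
    from has_sum_add[OF a this] show ?thesis by simp
  qed
  also have "(\<lambda>s. of_nat (2 * s + 1) * x ^ e s - of_nat (2 * s + 1) * x ^ e' s) = folded_theta x k i"
    unfolding folded_theta_def e_def e'_def by (simp add: fun_eq_iff right_diff_distrib)
  finally have "a - b = Z" using Z has_sum_unique unfolding x_def by blast
  moreover have "(?f has_sum (a + - b)) UNIV"
  proof (rule has_sum_int_split)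
    show "((\<lambda>s. ?f (int s)) has_sum a) UNIV" unfolding p by (rule a)
    show "((\<lambda>s. ?f (- int s - 1)) has_sum - b) UNIV"
      unfolding n mult_minus_left using b by (subst has_sum_uminus) simp
  qed
  ultimately show ?thesis by simp
qed

section \<open>Tuples and partial sums\<close>

text \<open>The partial sum \<open>N\<^sub>t = n\<^sub>t + \<dots> + n\<^sub>k\<^sub>-\<^sub>1 + (n\<^sub>k + n\<^sub>k\<^sub>+\<^sub>1)/2\<close>; the division is exact for the
  tuples considered.\<close>
definition tail_sum :: "nat \<Rightarrow> nat \<Rightarrow> (nat \<Rightarrow> nat) \<Rightarrow> nat" where
  "tail_sum k t n = (\<Sum>j\<in>{t..<k}. n j) + (n k + n (k + 1)) div 2"

text \<open>The possible final segments \<open>(n\<^sub>t, \<dots>, n\<^sub>k\<^sub>+\<^sub>1)\<close> of a tuple with \<open>N\<^sub>t = L\<close>, as extensional functions on \<open>{t..k+1}\<close>.\<close>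
definition tails :: "nat \<Rightarrow> nat \<Rightarrow> nat \<Rightarrow> (nat \<Rightarrow> nat) set" where
  "tails k t L = {n \<in> {t..k + 1} \<rightarrow>\<^sub>E UNIV. [n k = n (k + 1)] (mod 2) \<and> tail_sum k t n = L}"

text \<open>The weight of a level variable \<open>N\<close> with \<open>m\<close> levels below it in the chain.\<close>
definition level_weight :: "complex \<Rightarrow> nat \<Rightarrow> nat \<Rightarrow> nat \<Rightarrow> complex" where
  "level_weight q i m N = q ^ (N\<^sup>2 + (if m < i then N else 0))"

text \<open>The part of the summand that depends on \<open>N\<^sub>t\<^sub>+\<^sub>1, \<dots>, N\<^sub>k\<close>, on \<open>j\<close> and on the factors \<open>(q)\<^bsub>n\<^sub>r\<^esub>\<close> with
  \<open>r \<ge> t\<close>. The number \<open>\<bar>j\<bar>\<close> is written as the distance of \<open>n\<^sub>k\<close> from \<open>(n\<^sub>k + n\<^sub>k\<^sub>+\<^sub>1)/2\<close>.\<close>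
definition tail_weight :: "complex \<Rightarrow> nat \<Rightarrow> nat \<Rightarrow> nat \<Rightarrow> (nat \<Rightarrow> nat) \<Rightarrow> complex" where
  "tail_weight q i k t n =
     (\<Prod>r\<in>{t..<k}. level_weight q i (k - Suc r) (tail_sum k (Suc r) n) / qfac q (n r))
     * (q ^ ((nat \<bar>int (n k) - int ((n k + n (k + 1)) div 2)\<bar>)\<^sup>2) / (qfac q (n k) * qfac q (n (k + 1))))"

lemma tail_sum_upd: "t < r \<Longrightarrow> t < k \<Longrightarrow> tail_sum k r (n(t := v)) = tail_sum k r n"
  by (auto simp: tail_sum_def intro!: sum.cong)

lemma tail_sum_rec: "t < k \<Longrightarrow> tail_sum k t n = n t + tail_sum k (Suc t) n"
  by (simp add: tail_sum_def sum.atLeast_Suc_lessThan)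

lemma tail_weight_upd:
  assumes "t < k"
  shows "tail_weight q i k t (n(t := v)) =
    level_weight q i (k - Suc t) (tail_sum k (Suc t) n) / qfac q v * tail_weight q i k (Suc t) n"
proof -
  have "(\<Prod>r\<in>{Suc t..<k}. level_weight q i (k - Suc r) (tail_sum k (Suc r) (n(t := v))) / qfac q ((n(t := v)) r))
      = (\<Prod>r\<in>{Suc t..<k}. level_weight q i (k - Suc r) (tail_sum k (Suc r) n) / qfac q (n r))"
    by (intro prod.cong) (auto simp: tail_sum_upd)
  then show ?thesis
    using assms unfolding tail_weight_def
    by (simp add: prod.atLeast_Suc_lessThan tail_sum_upd)
qed

lemma finite_tails: "finite (tails k t L)"
proof (rule finite_subset)
  show "tails k t L \<subseteq> {t..k + 1} \<rightarrow>\<^sub>E {..2 * L + 1}"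
  proof (rule subsetI, rule PiE_I)
    fix n j assume n: "n \<in> tails k t L" and j: "j \<in> {t..k + 1}"
    then have L: "tail_sum k t n = L" by (simp add: tails_def)
    consider "j \<in> {t..<k}" | "j = k" | "j = k + 1" using j by force
    then show "n j \<in> {..2 * L + 1}"
    proof cases
      case 1
      then have "n j \<le> (\<Sum>j\<in>{t..<k}. n j)" by (intro member_le_sum) auto
      with L show ?thesis by (simp add: tail_sum_def)
    qed (use L in \<open>auto simp: tail_sum_def\<close>)
  qed (auto simp: tails_def PiE_def extensional_def)
qed (simp add: finite_PiE)

text \<open>A segment starting at \<open>t < k\<close> with \<open>N\<^sub>t = L\<close> is a segment starting at \<open>t + 1\<close> with some
  \<open>N\<^sub>t\<^sub>+\<^sub>1 = N \<le> L\<close>, together with \<open>n\<^sub>t = L - N\<close>; this is the recursion of the chain.\<close>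
lemma sum_tails:
  assumes "m < k"
  shows "(\<Sum>n\<in>tails k (k - m) L. tail_weight q i k (k - m) n) = bailey_chain q i m L"
  using assms
proof (induction m arbitrary: L)
  case 0
  have "(\<Sum>n\<in>tails k k L. tail_weight q i k k n) = bailey_chain q i 0 L"
    unfolding bailey_chain.simps
  proof (rule sum.reindex_bij_witness[of _ "\<lambda>a j. if j = k then a else if j = k + 1 then 2 * L - a else undefined" "\<lambda>n. n k"])
    fix n assume n: "n \<in> tails k k L"
    then have par: "n k mod 2 = n (Suc k) mod 2" and L: "(n k + n (Suc k)) div 2 = L"
      and ext: "\<And>j. j \<notin> {k..k + 1} \<Longrightarrow> n j = undefined"
      by (auto simp: tails_def tail_sum_def cong_def PiE_def extensional_def)
    have eq: "n k + n (Suc k) = 2 * L" using par L by presburger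
    show "n k \<in> {..2 * L}" using eq by simp
    show "(\<lambda>j. if j = k then n k else if j = k + 1 then 2 * L - n k else undefined) = n"
      using eq ext by (auto simp: fun_eq_iff)
    have "n (Suc k) = 2 * L - n k" using eq by simp
    then show "q ^ ((nat \<bar>int (n k) - int L\<bar>)\<^sup>2) / (qfac q (n k) * qfac q (2 * L - n k)) = tail_weight q i k k n"
      unfolding tail_weight_def using L by simp
  next
    fix a assume a: "a \<in> {..2 * L}"
    then have "a \<le> 2 * L" by simp
    then obtain b where b: "2 * L = a + b" by (auto simp: le_iff_add)
    then have "even (a + b)" by (metis dvd_triv_left)
    then have "a mod 2 = (2 * L - a) mod 2" unfolding b by (simp add: mod2_eq_if)
    then have "[a = 2 * L - a] (mod 2)" unfolding cong_def .
    with a show "(\<lambda>j. if j = k then a else if j = k + 1 then 2 * L - a else undefined) \<in> tails k k L"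
      by (auto simp: tails_def tail_sum_def)
  qed auto
  then show ?case by simp
next
  case (Suc m)
  define t where "t = k - Suc m"
  have t: "t < k" "k - m = Suc t" "k - Suc t = m" using Suc.prems by (auto simp: t_def)
  have IH: "bailey_chain q i m N = (\<Sum>n\<in>tails k (Suc t) N. tail_weight q i k (Suc t) n)" for N
    using Suc.IH[of N] Suc.prems unfolding t(2) by simp
  have "bailey_chain q i (Suc m) L
      = (\<Sum>N\<le>L. \<Sum>n\<in>tails k (Suc t) N. level_weight q i m N / qfac q (L - N) * tail_weight q i k (Suc t) n)"
    unfolding bailey_chain.simps level_weight_def[symmetric] IH
    by (simp add: sum_distrib_left sum_divide_distrib mult_ac)
  also have "\<dots> = (\<Sum>(N, n)\<in>Sigma {..L} (tails k (Suc t)). level_weight q i m N / qfac q (L - N) * tail_weight q i k (Suc t) n)"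
    by (intro sum.Sigma) (auto simp: finite_tails)
  also have "\<dots> = (\<Sum>n\<in>tails k t L. tail_weight q i k t n)"
  proof (rule sum.reindex_bij_witness[of _ "\<lambda>n. (tail_sum k (Suc t) n, n(t := undefined))" "\<lambda>(N, n). n(t := L - N)"], goal_cases)
    case (1 p)
    then obtain N n where p: "p = (N, n)" "N \<le> L" "n \<in> tails k (Suc t) N" by auto
    then have "n t = undefined" by (auto simp: tails_def PiE_def extensional_def)
    moreover have "tail_sum k (Suc t) n = N" using p by (simp add: tails_def)
    ultimately show ?case using t by (simp add: p(1) tail_sum_upd fun_upd_idem)
  next
    case (2 p)
    then obtain N n where p: "p = (N, n)" "N \<le> L" "n \<in> tails k (Suc t) N" by auto
    then show ?case using t by (auto simp: tails_def tail_sum_rec tail_sum_upd PiE_def extensional_def)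
  next
    case (3 n)
    then show ?case using t by (auto simp: tails_def tail_sum_rec)
  next
    case (4 n)
    then show ?case using t by (auto simp: tails_def tail_sum_rec tail_sum_upd PiE_def extensional_def)
  next
    case (5 p)
    then obtain N n where p: "p = (N, n)" "N \<le> L" "n \<in> tails k (Suc t) N" by auto
    then have "tail_sum k (Suc t) n = N" by (simp add: tails_def)
    then show ?case by (simp add: p(1) tail_weight_upd t)
  qed
  finally show ?case unfolding t_def by simp
qed

section \<open>The exponent in terms of partial sums\<close>

lemma sum_of_final_segments:
  fixes X :: "nat \<Rightarrow> real"
  shows "(\<Sum>t=p+1..K. \<Sum>r=t..K. X r) = (\<Sum>r=p+1..K. real (r - p) * X r)"
proof (induction K)
  case (Suc K)
  show ?case
  proof (cases "p \<le> K")
    case True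
    have "(\<Sum>t=p+1..Suc K. \<Sum>r=t..Suc K. X r) = (\<Sum>t=p+1..K. (\<Sum>r=t..K. X r) + X (Suc K)) + X (Suc K)"
      using True by (simp add: sum.nat_ivl_Suc')
    also have "\<dots> = (\<Sum>r=p+1..K. real (r - p) * X r) + real (Suc K - p) * X (Suc K)"
      using True Suc by (simp add: sum.distrib algebra_simps of_nat_diff)
    finally show ?thesis using True by (simp add: sum.nat_ivl_Suc')
  qed simp
qed simp

lemma min_quadratic_form:
  fixes X :: "nat \<Rightarrow> real"
  shows "(\<Sum>r=1..K. \<Sum>s=1..K. X r * min (2 * real r - 1) (2 * real s - 1) * X s)
     = 2 * (\<Sum>t=1..K. (\<Sum>r=t..K. X r)\<^sup>2) - (\<Sum>r=1..K. X r)\<^sup>2"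
proof (induction K)
  case (Suc K)
  let ?S = "\<lambda>t. \<Sum>r=t..K. X r" and ?x = "X (Suc K)"
  let ?m = "\<lambda>r s. min (2 * real r - 1) (2 * real s - 1)"
  have odd: "(\<Sum>s=1..K. (2 * real s - 1) * X s) = 2 * (\<Sum>t=1..K. ?S t) - ?S 1"
    using sum_of_final_segments[where p = 0 and K = K and X = X]
    by (simp add: sum_distrib_left sum_subtractf left_diff_distrib mult.assoc)
  have "(\<Sum>r=1..Suc K. \<Sum>s=1..Suc K. X r * ?m r s * X s)
      = (\<Sum>r=1..K. \<Sum>s=1..K. X r * ?m r s * X s) + (\<Sum>r=1..K. X r * ?m r (Suc K) * ?x)
       + (\<Sum>s=1..K. ?x * ?m (Suc K) s * X s) + ?x * ?m (Suc K) (Suc K) * ?x"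
    by (simp add: sum.distrib)
  also have "(\<Sum>r=1..K. X r * ?m r (Suc K) * ?x) = ?x * (\<Sum>s=1..K. (2 * real s - 1) * X s)"
    unfolding sum_distrib_left by (intro sum.cong) (auto simp: min_def)
  also have "(\<Sum>s=1..K. ?x * ?m (Suc K) s * X s) = ?x * (\<Sum>s=1..K. (2 * real s - 1) * X s)"
    unfolding sum_distrib_left by (intro sum.cong) (auto simp: min_def)
  also note odd
  also note Suc.IH
  also have "2 * (\<Sum>t=1..K. (?S t)\<^sup>2) - (?S 1)\<^sup>2 + ?x * (2 * (\<Sum>t=1..K. ?S t) - ?S 1) + ?x * (2 * (\<Sum>t=1..K. ?S t) - ?S 1)
       + ?x * ?m (Suc K) (Suc K) * ?x
     = 2 * ((\<Sum>t=1..K. (?S t + ?x)\<^sup>2) + ?x\<^sup>2) - (?S 1 + ?x)\<^sup>2"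
    by (simp add: power2_sum sum.distrib sum_distrib_left sum_distrib_right algebra_simps power2_eq_square)
  also have "(\<Sum>t=1..K. (?S t + ?x)\<^sup>2) + ?x\<^sup>2 = (\<Sum>t=1..Suc K. (\<Sum>r=t..Suc K. X r)\<^sup>2)"
    by simp
  also have "?S 1 + ?x = (\<Sum>r=1..Suc K. X r)" by simp
  finally show ?case .
qed simp

text \<open>The vector \<open>(n\<^sub>1, \<dots>, n\<^sub>k\<^sub>-\<^sub>1, m)\<close> in which the last two entries of a tuple are replaced by their
  arithmetic mean \<open>m\<close>.\<close>
definition merged :: "nat \<Rightarrow> (nat \<Rightarrow> nat) \<Rightarrow> nat \<Rightarrow> real" where
  "merged k n r = (if r = k then (real (n k) + real (n (k + 1))) / 2 else real (n r))"

text \<open>In the variables \<open>m\<close> and \<open>j\<close> the quadratic form splits: \<open>m\<close> continues the pattern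
  \<open>min (2r - 1) (2s - 1)\<close> of the first \<open>k - 1\<close> variables, and \<open>j\<close> contributes \<open>2j\<^sup>2\<close>.\<close>
lemma quad_form_merged:
  assumes "k \<ge> 1"
  shows "quad_form k n = (\<Sum>r=1..k. \<Sum>s=1..k. merged k n r * min (2 * real r - 1) (2 * real s - 1) * merged k n s)
     + (real (n k) - real (n (k + 1)))\<^sup>2 / 2"
proof -
  define a b where "a = real (n k)" and "b = real (n (k + 1))"
  define P where "P = (\<Sum>s\<in>{1..<k}. (2 * real s - 1) * real (n s))"
  define R where "R = (\<Sum>r\<in>{1..<k}. \<Sum>s\<in>{1..<k}. real (n r) * min (2 * real r - 1) (2 * real s - 1) * real (n s))"
  have ins: "{1..k + 1} = insert (k + 1) (insert k {1..<k})" "{1..k} = insert k {1..<k}"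
    using assms by auto
  have "quad_form k n = (\<Sum>r\<in>{1..<k}. \<Sum>s\<in>{1..<k}. real (n r) * A_inv k r s * real (n s))
     + (\<Sum>r\<in>{1..<k}. real (n r) * A_inv k r k * a) + (\<Sum>r\<in>{1..<k}. real (n r) * A_inv k r (k + 1) * b)
     + (\<Sum>s\<in>{1..<k}. a * A_inv k k s * real (n s)) + (\<Sum>s\<in>{1..<k}. b * A_inv k (k + 1) s * real (n s))
     + a * A_inv k k k * a + a * A_inv k k (k + 1) * b + b * A_inv k (k + 1) k * a + b * A_inv k (k + 1) (k + 1) * b"
    unfolding quad_form_def ins a_def b_def by (simp add: sum.distrib)
  also have "(\<Sum>r\<in>{1..<k}. \<Sum>s\<in>{1..<k}. real (n r) * A_inv k r s * real (n s)) = R"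
    unfolding R_def by (intro sum.cong) (auto simp: A_inv_def)
  also have "(\<Sum>r\<in>{1..<k}. real (n r) * A_inv k r k * a) = a / 2 * P"
    unfolding P_def sum_distrib_left by (intro sum.cong) (auto simp: A_inv_def)
  also have "(\<Sum>r\<in>{1..<k}. real (n r) * A_inv k r (k + 1) * b) = b / 2 * P"
    unfolding P_def sum_distrib_left by (intro sum.cong) (auto simp: A_inv_def)
  also have "(\<Sum>s\<in>{1..<k}. a * A_inv k k s * real (n s)) = a / 2 * P"
    unfolding P_def sum_distrib_left by (intro sum.cong) (auto simp: A_inv_def)
  also have "(\<Sum>s\<in>{1..<k}. b * A_inv k (k + 1) s * real (n s)) = b / 2 * P"
    unfolding P_def sum_distrib_left by (intro sum.cong) (auto simp: A_inv_def)
  also have "R + a / 2 * P + b / 2 * P + a / 2 * P + b / 2 * P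
     + a * A_inv k k k * a + a * A_inv k k (k + 1) * b + b * A_inv k (k + 1) k * a + b * A_inv k (k + 1) (k + 1) * b
     = R + (a + b) / 2 * P + (a + b) / 2 * P + (a + b) / 2 * (2 * real k - 1) * ((a + b) / 2) + (a - b)\<^sup>2 / 2"
    by (simp add: A_inv_def power2_eq_square field_simps)
  also have "R + (a + b) / 2 * P + (a + b) / 2 * P + (a + b) / 2 * (2 * real k - 1) * ((a + b) / 2)
     = (\<Sum>r=1..k. \<Sum>s=1..k. merged k n r * min (2 * real r - 1) (2 * real s - 1) * merged k n s)"
  proof -
    define f where "f r s = merged k n r * min (2 * real r - 1) (2 * real s - 1) * merged k n s" for r s
    have "(\<Sum>r=1..k. \<Sum>s=1..k. f r s)
      = (\<Sum>r\<in>{1..<k}. \<Sum>s\<in>{1..<k}. f r s) + (\<Sum>r\<in>{1..<k}. f r k) + (\<Sum>s\<in>{1..<k}. f k s) + f k k"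
      unfolding ins by (simp add: sum.distrib)
    also have "(\<Sum>r\<in>{1..<k}. \<Sum>s\<in>{1..<k}. f r s) = R"
      unfolding R_def f_def by (intro sum.cong) (auto simp: merged_def)
    also have "(\<Sum>r\<in>{1..<k}. f r k) = (a + b) / 2 * P"
      unfolding P_def sum_distrib_left a_def b_def f_def by (intro sum.cong) (auto simp: merged_def min_def)
    also have "(\<Sum>s\<in>{1..<k}. f k s) = (a + b) / 2 * P"
      unfolding P_def sum_distrib_left a_def b_def f_def by (intro sum.cong) (auto simp: merged_def min_def)
    also have "f k k = (a + b) / 2 * (2 * real k - 1) * ((a + b) / 2)"
      by (simp add: f_def merged_def a_def b_def)
    finally show ?thesis unfolding f_def by simp
  qed
  finally show ?thesis by (simp add: a_def b_def)
qed

lemma tail_sum_merged: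
  assumes "[n k = n (k + 1)] (mod 2)" "t \<le> k"
  shows "real (tail_sum k t n) = (\<Sum>r=t..k. merged k n r)"
proof -
  have "2 dvd n k + n (k + 1)"
    using assms(1) unfolding cong_def by presburger
  then have "real ((n k + n (k + 1)) div 2) = merged k n k"
    by (simp add: merged_def real_of_nat_div)
  moreover have "{t..k} = insert k {t..<k}" using assms(2) by auto
  moreover have "(\<Sum>r\<in>{t..<k}. merged k n r) = real (\<Sum>r\<in>{t..<k}. n r)"
    unfolding of_nat_sum by (intro sum.cong) (auto simp: merged_def)
  ultimately show ?thesis by (simp add: tail_sum_def)
qed

lemma lin_form_tail_sum:
  assumes par: "[n k = n (k + 1)] (mod 2)" and "i \<le> k"
  shows "lin_form k i n = (\<Sum>t=k-i+1..k. real (tail_sum k t n))"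
proof -
  have "(\<Sum>t=k-i+1..k. real (tail_sum k t n)) = (\<Sum>t=(k-i)+1..k. \<Sum>r=t..k. merged k n r)"
    by (intro sum.cong) (auto simp: tail_sum_merged[OF par])
  also have "\<dots> = (\<Sum>r=(k-i)+1..k. real (r - (k - i)) * merged k n r)"
    by (rule sum_of_final_segments)
  also have "\<dots> = lin_form k i n"
  proof (cases "i = 0")
    case False
    then have "{k-i+1..k} = insert k {k-i+1..k-1}" "k \<notin> {k-i+1..k-1}" using assms(2) by auto
    then have "(\<Sum>r=(k-i)+1..k. real (r - (k - i)) * merged k n r)
      = real (k - (k - i)) * merged k n k + (\<Sum>r=k-i+1..k-1. real (r - (k - i)) * merged k n r)"
      by simp
    also have "(\<Sum>r=k-i+1..k-1. real (r - (k - i)) * merged k n r) = (\<Sum>j=k-i+1..k-1. real (j + i - k) * real (n j))"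
    proof (rule sum.cong)
      fix r assume r: "r \<in> {k-i+1..k-1}"
      then have "r \<noteq> k" "r - (k - i) = r + i - k" using assms(2) by auto
      then show "real (r - (k - i)) * merged k n r = real (r + i - k) * real (n r)"
        by (simp add: merged_def)
    qed simp
    finally show ?thesis using assms(2) by (simp add: lin_form_def merged_def)
  qed (simp add: lin_form_def)
  finally show ?thesis by simp
qed

lemma tuple_exponent:
  assumes k: "k \<ge> 1" "i \<le> k" and par: "[n k = n (k + 1)] (mod 2)"
  defines "N \<equiv> \<lambda>t. tail_sum k t n"
  defines "d \<equiv> nat \<bar>int (n k) - int ((n k + n (k + 1)) div 2)\<bar>"
  shows "quad_form k n / 2 + lin_form k i n
     = real ((N 1)\<^sup>2 + (if k - 1 < i then 2 * N 1 else 0)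
        + (\<Sum>r\<in>{1..<k}. 2 * ((N (Suc r))\<^sup>2 + (if k - Suc r < i then N (Suc r) else 0))) + 2 * d\<^sup>2) * (1/2)"
proof -
  have split: "(\<Sum>t=1..k. g t) = g 1 + (\<Sum>r\<in>{1..<k}. g (Suc r))" for g :: "nat \<Rightarrow> real"
  proof -
    have "(\<Sum>t=1..k. g t) = g 1 + (\<Sum>t\<in>{Suc 1..<Suc k}. g t)"
      using k(1) by (simp add: sum.atLeast_Suc_atMost atLeastLessThanSuc_atLeastAtMost)
    then show ?thesis by (simp only: sum.shift_bounds_Suc_ivl)
  qed
  have 1: "(\<Sum>r=1..k. \<Sum>s=1..k. merged k n r * min (2 * real r - 1) (2 * real s - 1) * merged k n s)
     = (real (N 1))\<^sup>2 + 2 * (\<Sum>r\<in>{1..<k}. (real (N (Suc r)))\<^sup>2)"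
  proof -
    have a: "(\<Sum>t=1..k. (\<Sum>r=t..k. merged k n r)\<^sup>2) = (\<Sum>t=1..k. (real (N t))\<^sup>2)"
      unfolding N_def by (intro sum.cong) (auto simp: tail_sum_merged[OF par])
    have b: "(\<Sum>r=1..k. merged k n r) = real (N 1)"
      unfolding N_def using tail_sum_merged[OF par, of 1] k(1) by simp
    show ?thesis unfolding min_quadratic_form a b unfolding split by simp
  qed
  have 2: "lin_form k i n = (if k - 1 < i then real (N 1) else 0)
     + (\<Sum>r\<in>{1..<k}. if k - Suc r < i then real (N (Suc r)) else 0)"
  proof -
    have "lin_form k i n = (\<Sum>t=k-i+1..k. if k - t < i then real (N t) else 0)"
      unfolding lin_form_tail_sum[OF par k(2)] N_def by (intro sum.cong) auto
    also have "\<dots> = (\<Sum>t=1..k. if k - t < i then real (N t) else 0)"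
      by (rule sum.mono_neutral_left) auto
    finally show ?thesis unfolding split .
  qed
  have 3: "(real (n k) - real (n (k + 1)))\<^sup>2 / 2 = 2 * (real d)\<^sup>2"
  proof -
    have "2 dvd n k + n (k + 1)" using par unfolding cong_def by presburger
    then have m: "real ((n k + n (k + 1)) div 2) = (real (n k) + real (n (k + 1))) / 2"
      by (simp add: real_of_nat_div)
    have d: "(real d)\<^sup>2 = (real (n k) - real ((n k + n (k + 1)) div 2))\<^sup>2"
    proof -
      have "real d = \<bar>real (n k) - real ((n k + n (k + 1)) div 2)\<bar>" unfolding d_def by linarith
      then show ?thesis by (simp only: power2_abs)
    qed
    show ?thesis unfolding d m by (simp add: power2_eq_square field_simps)
  qed
  show ?thesis
    unfolding quad_form_merged[OF k(1)] 1 2 3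
    by (simp add: sum.distrib sum_distrib_left[symmetric] of_nat_sum if_distrib[of real] cong: if_cong)
qed

section \<open>Summation over tuples\<close>

lemma tuple_term_factor:
  assumes k: "k \<ge> 1" "i \<le> k" and n: "n \<in> tails k 1 L"
  shows "tuple_term \<tau> k i n
    = outer_weight (qpow \<tau> (1/2)) i (k - 1) L * tail_weight ((qpow \<tau> (1/2))\<^sup>2) i k 1 n"
proof -
  define x where "x = qpow \<tau> (1/2)"
  have q: "qpow \<tau> 1 = x\<^sup>2"
    using qpow_of_nat_mult[of \<tau> 2 "1/2"] by (simp add: x_def)
  have par: "[n k = n (k + 1)] (mod 2)" and L: "tail_sum k 1 n = L" using n by (auto simp: tails_def)
  define d where "d = nat \<bar>int (n k) - int ((n k + n (k + 1)) div 2)\<bar>"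
  define l where "l r = (tail_sum k (Suc r) n)\<^sup>2 + (if k - Suc r < i then tail_sum k (Suc r) n else 0)" for r
  have "qpow \<tau> (quad_form k n / 2 + lin_form k i n)
      = x ^ (L\<^sup>2 + (if k - 1 < i then 2 * L else 0) + (\<Sum>r\<in>{1..<k}. 2 * l r) + 2 * d\<^sup>2)"
    unfolding tuple_exponent[OF k par] qpow_of_nat_mult L l_def d_def x_def ..
  also have "\<dots> = x ^ (L\<^sup>2 + (if k - 1 < i then 2 * L else 0)) * (\<Prod>r\<in>{1..<k}. (x\<^sup>2) ^ l r) * (x\<^sup>2) ^ (d\<^sup>2)"
    unfolding power_add[of x "_ + _" "2 * d\<^sup>2"] power_add[of x _ "\<Sum>r\<in>{1..<k}. 2 * l r"] power_sum power_mult[of x 2] ..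
  finally have e: "qpow \<tau> (quad_form k n / 2 + lin_form k i n)
     = x ^ (L\<^sup>2 + (if k - 1 < i then 2 * L else 0)) * (\<Prod>r\<in>{1..<k}. (x\<^sup>2) ^ l r) * (x\<^sup>2) ^ (d\<^sup>2)" .
  have "{1..k + 1} = insert (k + 1) (insert k {1..<k})" using k(1) by auto
  then have den: "(\<Prod>j=1..k+1. qfac (x\<^sup>2) (n j)) = (\<Prod>j\<in>{1..<k}. qfac (x\<^sup>2) (n j)) * (qfac (x\<^sup>2) (n k) * qfac (x\<^sup>2) (n (k + 1)))"
    by (simp add: mult_ac)
  have "{1..k-1} = {1..<k}" using k(1) by auto
  then have ind: "(\<Sum>j=1..k-1. n j) + (n k + n (k + 1)) div 2 = L"
    using L by (simp add: tail_sum_def)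
  show ?thesis
    unfolding tuple_term_def q x_def[symmetric] e den ind outer_weight_def tail_weight_def level_weight_def
      l_def[symmetric] d_def[symmetric] prod_dividef
    by simp
qed

text \<open>The exponent of \<open>x\<close> is at least \<open>N\<^sub>1\<^sup>2 \<ge> N\<^sub>1\<close>, and \<open>2 N\<^sub>1 \<ge> n\<^sub>1 + \<dots> + n\<^sub>k\<^sub>+\<^sub>1\<close>, so the summand is dominated
  by a product of geometric sequences of ratio \<open>\<rho> = \<bar>x\<bar>\<^sup>1\<^sup>/\<^sup>2\<close> in the single variables.\<close>
lemma tuple_term_abs_summable:
  assumes \<tau>: "Im \<tau> > 0" and k: "k \<ge> 1" "i \<le> k"
  shows "(\<lambda>n. norm (tuple_term \<tau> k i n)) summable_on tuples k"
proof -
  define x where "x = qpow \<tau> (1/2)"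
  have x: "norm x < 1" unfolding x_def by (rule norm_qpow_less_1[OF \<tau>]) simp
  note q = norm_power2_less_1[OF x]
  have qx: "qpow \<tau> 1 = x\<^sup>2"
    using qpow_of_nat_mult[of \<tau> 2 "1/2"] by (simp add: x_def)
  define \<rho> where "\<rho> = sqrt (norm x)"
  have \<rho>: "0 \<le> \<rho>" "\<rho> < 1" "\<rho>\<^sup>2 = norm x" using x by (auto simp: \<rho>_def real_sqrt_lt_1_iff)
  obtain C where C: "C > 0" "\<And>n. norm (1 / qfac (x\<^sup>2) n) \<le> C"
    using inverse_qfac_bounded[OF q] by blast
  obtain D where D: "D > 0" "\<And>n. norm (qpoch (- x) (x\<^sup>2) n) \<le> D"
    using qpoch_bounded[OF q] by blast
  have "(\<lambda>m. norm (C * \<rho> ^ m)) summable_on UNIV"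
    using \<rho>(1,2) C(1) by (intro norm_summable_imp_summable_on) (simp add: abs_mult summable_mult summable_geometric)
  then have "(\<lambda>n. norm (\<Prod>j\<in>{1..k + 1}. C * \<rho> ^ n j)) summable_on ({1..k + 1} \<rightarrow>\<^sub>E UNIV)"
    unfolding abs_summable_equivalent by (intro Infinite_Set_Sum.abs_summable_on_prod_PiE) auto
  then have "(\<lambda>n. \<Prod>j\<in>{1..k + 1}. C * \<rho> ^ n j) summable_on ({1..k + 1} \<rightarrow>\<^sub>E UNIV)"
    by (rule abs_summable_summable)
  then have "(\<lambda>n. \<Prod>j\<in>{1..k + 1}. C * \<rho> ^ n j) summable_on tuples k"
    by (rule summable_on_subset_banach) (auto simp: tuples_def)
  then have "(\<lambda>n. D * (\<Prod>j\<in>{1..k + 1}. C * \<rho> ^ n j)) summable_on tuples k"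
    by (rule summable_on_cmult_right)
  then show ?thesis
  proof (rule Infinite_Sum.abs_summable_on_comparison_test')
    fix n assume "n \<in> tuples k"
    then have par: "[n k = n (k + 1)] (mod 2)" by (simp add: tuples_def)
    define L where "L = tail_sum k 1 n"
    obtain E where E: "quad_form k n / 2 + lin_form k i n = real E * (1/2)" "L \<le> E"
    proof (rule that[OF tuple_exponent[OF k par]])
      show "L \<le> (tail_sum k 1 n)\<^sup>2 + (if k - 1 < i then 2 * tail_sum k 1 n else 0) +
        (\<Sum>r\<in>{1..<k}. 2 * ((tail_sum k (Suc r) n)\<^sup>2 + (if k - Suc r < i then tail_sum k (Suc r) n else 0))) +
        2 * (nat \<bar>int (n k) - int ((n k + n (k + 1)) div 2)\<bar>)\<^sup>2"
        unfolding L_def by (simp add: power2_eq_square trans_le_add1)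
    qed
    define h where "h = (n k + n (k + 1)) div 2"
    have "{1..k + 1} = insert (k + 1) (insert k {1..<k})" using k(1) by auto
    then have "(\<Sum>j=1..k+1. n j) = (\<Sum>j\<in>{1..<k}. n j) + (n k + n (k + 1))" by simp
    moreover have "n k + n (k + 1) = 2 * h"
      using par unfolding cong_def h_def by presburger
    ultimately have total: "(\<Sum>j=1..k+1. n j) = (\<Sum>j\<in>{1..<k}. n j) + 2 * h" by (simp only:)
    have sum_le: "(\<Sum>j=1..k+1. n j) \<le> 2 * L"
      unfolding total unfolding L_def tail_sum_def h_def[symmetric] by simp
    have "norm (x ^ E) \<le> norm x ^ L" by (rule power_le_power_le_1[OF x E(2)])
    also have "\<dots> = \<rho> ^ (2 * L)" by (simp only: power_mult \<rho>(3))
    also have "\<dots> \<le> \<rho> ^ (\<Sum>j=1..k+1. n j)" using \<rho> sum_le by (intro power_decreasing) auto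
    finally have xE: "norm (x ^ E) \<le> (\<Prod>j=1..k+1. \<rho> ^ n j)" unfolding power_sum .
    have "norm (\<Prod>j=1..k+1. 1 / qfac (x\<^sup>2) (n j)) \<le> (\<Prod>j=1..k+1. C)"
      unfolding prod_norm[symmetric] by (intro prod_mono) (use C(2) in auto)
    moreover have "tuple_term \<tau> k i n = qpoch (- x) (x\<^sup>2) ((\<Sum>j=1..k-1. n j) + (n k + n (k + 1)) div 2)
        * (x ^ E * (\<Prod>j=1..k+1. 1 / qfac (x\<^sup>2) (n j)))"
      unfolding tuple_term_def qx E(1) qpow_of_nat_mult x_def[symmetric] prod_dividef by simp
    moreover have "(\<Prod>j=1..k+1. C * \<rho> ^ n j) = (\<Prod>j=1..k+1. \<rho> ^ n j) * (\<Prod>j=1..k+1. C)"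
      by (simp only: prod.distrib mult.commute)
    ultimately show "norm (tuple_term \<tau> k i n) \<le> D * (\<Prod>j=1..k+1. C * \<rho> ^ n j)"
      using D xE \<rho>(1) C(1) by (simp only: norm_mult) (intro mult_mono; simp add: prod_nonneg)
  qed
qed

theorem theorem4p2:
  fixes \<tau> :: complex and i k :: nat
  assumes "Im \<tau> > 0" and "k \<ge> 1" and "i \<le> k"
  shows "theta_term \<tau> k i summable_on UNIV \<and>
    tuple_term \<tau> k i summable_on tuples k \<and>
    qpow \<tau> (- (real i)\<^sup>2 / (2 * (2 * real k + 1)))
      * (qpoch_inf (- qpow \<tau> (1/2)) (qpow \<tau> 1) / qpoch_inf (qpow \<tau> 1) (qpow \<tau> 1))
      * (\<Sum>\<^sub>\<infinity>n\<in>UNIV. theta_term \<tau> k i n)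
    = (\<Sum>\<^sub>\<infinity>n\<in>tuples k. tuple_term \<tau> k i n)"
proof -
  define x where "x = qpow \<tau> (1/2)"
  have x: "norm x < 1" unfolding x_def by (rule norm_qpow_less_1[OF assms(1)]) simp
  note q = norm_power2_less_1[OF x]
  have qx: "qpow \<tau> 1 = x\<^sup>2"
    using qpow_of_nat_mult[of \<tau> 2 "1/2"] by (simp add: x_def)
  define c where "c = qpoch_inf (- x) (x\<^sup>2) / qpoch_inf (x\<^sup>2) (x\<^sup>2)"
  have c: "c \<noteq> 0"
    unfolding c_def using qpoch_LIMSEQ(2)[OF q, of "- x"] qpoch_LIMSEQ(2)[OF q q] x by simp
  define p where "p = qpow \<tau> (- (real i)\<^sup>2 / (2 * (2 * real k + 1)))"
  have p: "p \<noteq> 0" by (simp add: p_def qpow_def)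
  obtain Z where Z: "((\<lambda>s. c * folded_theta x k i s) has_sum Z) UNIV"
      "((\<lambda>N. outer_weight x i (k - 1) N * bailey_chain (x\<^sup>2) i (k - 1) N) has_sum Z) UNIV"
    using bailey_chain_total[OF x assms(2,3)] unfolding c_def by blast
  have "(folded_theta x k i has_sum (Z / c)) UNIV"
    using has_sum_cmult_right[OF Z(1), of "1 / c"] c by (simp add: mult.assoc[symmetric])
  then have "((\<lambda>n. p * theta_term \<tau> k i n) has_sum (Z / c)) UNIV"
    unfolding p_def x_def by (rule theta_has_sum[OF assms])
  from has_sum_cmult_right[OF this, of "1 / p"]
  have theta: "(theta_term \<tau> k i has_sum (Z / c / p)) UNIV"
    using p by (simp add: mult.assoc[symmetric] mult.commute)
  have sm: "tuple_term \<tau> k i summable_on tuples k"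
    by (rule abs_summable_summable[OF tuple_term_abs_summable[OF assms]])
  then obtain S where S: "(tuple_term \<tau> k i has_sum S) (tuples k)" by (auto simp: summable_on_def)
  \<comment> \<open>the tuples are grouped by the value of \<open>N\<^sub>1\<close>\<close>
  have "bij_betw snd (Sigma UNIV (tails k 1)) (tuples k)"
    by (rule bij_betwI[of _ _ _ "\<lambda>n. (tail_sum k 1 n, n)"]) (auto simp: tails_def tuples_def PiE_def extensional_def)
  then have "((\<lambda>p. tuple_term \<tau> k i (snd p)) has_sum S) (Sigma UNIV (tails k 1))"
    using S by (rule has_sum_reindex_bij_betw[THEN iffD2])
  then have "((\<lambda>N. \<Sum>n\<in>tails k 1 N. tuple_term \<tau> k i n) has_sum S) UNIV"
    by (rule has_sum_SigmaD) (use has_sum_finite[OF finite_tails] in simp)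
  also have "(\<lambda>N. \<Sum>n\<in>tails k 1 N. tuple_term \<tau> k i n)
      = (\<lambda>N. outer_weight x i (k - 1) N * bailey_chain (x\<^sup>2) i (k - 1) N)"
  proof
    fix N
    have k1: "k - (k - 1) = 1" "k - 1 < k" using assms(2) by auto
    have "(\<Sum>n\<in>tails k 1 N. tuple_term \<tau> k i n) = (\<Sum>n\<in>tails k 1 N. outer_weight x i (k - 1) N * tail_weight (x\<^sup>2) i k 1 n)"
      unfolding x_def using tuple_term_factor[OF assms(2,3)] by (intro sum.cong) auto
    also have "\<dots> = outer_weight x i (k - 1) N * bailey_chain (x\<^sup>2) i (k - 1) N"
      using sum_tails[OF k1(2), of "x\<^sup>2" i N] unfolding k1(1) by (simp add: sum_distrib_left[symmetric])
    finally show "(\<Sum>n\<in>tails k 1 N. tuple_term \<tau> k i n) = outer_weight x i (k - 1) N * bailey_chain (x\<^sup>2) i (k - 1) N" .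
  qed
  finally have "S = Z" using Z(2) has_sum_unique by blast
  with S have "(\<Sum>\<^sub>\<infinity>n\<in>tuples k. tuple_term \<tau> k i n) = Z" by (simp add: infsumI)
  moreover have "(\<Sum>\<^sub>\<infinity>n\<in>UNIV. theta_term \<tau> k i n) = Z / c / p" using theta by (simp add: infsumI)
  ultimately show ?thesis
    unfolding qx x_def[symmetric] c_def[symmetric] p_def[symmetric]
    using theta sm p c by (auto simp: summable_on_def)
qed

end
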